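(* Let $K$ be a convex body in $\mathbb{R}^n$, let $x\in K^o$ and $y\in\mathbb{R}^n\setminus\{0\}$. Then the limit $\lim_{t\to 0^+}\frac{V_K(x+ity)}{t}$ exists and $$\delta_B(x,y):=\lim_{t\to 0^+}\frac{V_K(x+ity)}{t}=\frac{1}{b^*(x,y)}.$$
   Context: A convex body $K\subset\mathbb{R}^n$ is a compact convex set with non-empty interior in $\mathbb{R}^n$; $K^o$ denotes its interior relative to $\mathbb{R}^n$, and $\mathbb{R}^n\subset\mathbb{C}^n$ in the standard way. $L(\mathbb{C}^n)$ is the class of plurisubharmonic functions $u$ on $\mathbb{C}^n$ with $u(z)\le\log^+|z|+c(u)$ for some constant $c(u)$ depending on $u$. The Siciak–Zaharjuta extremal function of $K$ is $V_K(z):=\sup\{u(z):u\in L(\mathbb{C}^n),\ u\le 0\text{ on }K\}$. For $x\in K^o$ and $y\in\mathbb{R}^n\setminus\{0\}$, consider the (possibly degenerate) ellipses $\mathcal{E}_b(x,y)$ through $x$ with tangent direction $y$ at $x$, parametrized by $$r(\theta)=a\cos\theta+by\sin\theta+(x-a),\qquad \theta\in[0,2\pi],$$ with $a\in\mathbb{R}^n$ and $b>0$. Define $$b^*(x,y):=\sup\{b>0:\ \text{there is } a\in\mathbb{R}^n\text{ with } r(\theta)\in K\text{ for all }\theta\}.$$ *)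

theory Defs
  imports "HOL-Analysis.Analysis"
begin

definition convex_body :: "(real ^ 'n) set \<Rightarrow> bool" where
  "convex_body K \<longleftrightarrow> compact K \<and> convex K \<and> interior K \<noteq> {}"

text \<open>The standard inclusion of real n-space into complex n-space.\<close>

definition cvec :: "real ^ 'n \<Rightarrow> complex ^ 'n" where
  "cvec x = (\<chi> i. complex_of_real (x $ i))"

text \<open>The integral of an extended real function as positive part minus negative part
  (\<^const>\<open>e2ennreal\<close> sends negative values to 0). It is only used for upper semicontinuous
  functions with values less than \<^term>\<open>\<infinity> :: ereal\<close> on a compact interval. These are bounded
  above there, so the first term is finite and the value lies in \<open>[-\<infinity>, \<infinity>)\<close>.\<close>

definition ereal_integral :: "'a measure \<Rightarrow> ('a \<Rightarrow> ereal) \<Rightarrow> ereal" where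
  "ereal_integral M f =
     enn2ereal (\<integral>\<^sup>+ x. e2ennreal (f x) \<partial>M) - enn2ereal (\<integral>\<^sup>+ x. e2ennreal (- f x) \<partial>M)"

definition circle_mean :: "(complex \<Rightarrow> ereal) \<Rightarrow> complex \<Rightarrow> real \<Rightarrow> ereal" where
  "circle_mean v c r =
     ereal_integral (restrict_space lborel {0..2 * pi}) (\<lambda>\<theta>. v (c + of_real r * cis \<theta>))
       / ereal (2 * pi)"

definition usc :: "('a::topological_space \<Rightarrow> ereal) \<Rightarrow> bool" where
  "usc u \<longleftrightarrow> (\<forall>c. open {z. u z < c})"

text \<open>Subharmonic functions on the plane and plurisubharmonic functions on complex n-space,
  with values in \<open>[-\<infinity>, \<infinity>)\<close>. The constant function \<open>-\<infinity>\<close> is admitted; this does not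
  affect the supremum defining the extremal function, since 0 is always a competitor.\<close>

definition subharmonic :: "(complex \<Rightarrow> ereal) \<Rightarrow> bool" where
  "subharmonic v \<longleftrightarrow>
     usc v \<and> (\<forall>z. v z < \<infinity>) \<and> (\<forall>c. \<forall>r>0. v c \<le> circle_mean v c r)"

definition plurisubharmonic :: "(complex ^ 'n \<Rightarrow> ereal) \<Rightarrow> bool" where
  "plurisubharmonic u \<longleftrightarrow>
     usc u \<and> (\<forall>z. u z < \<infinity>) \<and> (\<forall>z w. subharmonic (\<lambda>\<zeta>. u (z + \<zeta> *s w)))"

text \<open>Note \<^prop>\<open>ln 0 = (0::real)\<close>, so the bound below is correct at the origin too.\<close>

definition log_plus :: "real \<Rightarrow> real" where
  "log_plus s = max 0 (ln s)"

definition lelong_class :: "(complex ^ 'n \<Rightarrow> ereal) set" where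
  "lelong_class =
     {u. plurisubharmonic u \<and> (\<exists>c::real. \<forall>z. u z \<le> ereal (log_plus (norm z) + c))}"

definition extremal_function :: "(real ^ 'n) set \<Rightarrow> complex ^ 'n \<Rightarrow> ereal" where
  "extremal_function K z = Sup {u z |u. u \<in> lelong_class \<and> (\<forall>x\<in>K. u (cvec x) \<le> 0)}"

definition ellipse ::
    "real ^ 'n \<Rightarrow> real \<Rightarrow> real ^ 'n \<Rightarrow> real ^ 'n \<Rightarrow> real \<Rightarrow> real ^ 'n" where
  "ellipse a b x y \<theta> = cos \<theta> *\<^sub>R a + (b * sin \<theta>) *\<^sub>R y + (x - a)"

text \<open>For \<open>x\<close> in the interior of a convex body and \<open>y \<noteq> 0\<close> the set below is nonempty (take
  \<open>a = 0\<close>) and bounded (the points at parameters \<open>\<pi>/2\<close> and \<open>3\<pi>/2\<close> differ by \<open>2by\<close>), so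
  this real supremum is a genuine one.\<close>

definition b_star :: "(real ^ 'n) set \<Rightarrow> real ^ 'n \<Rightarrow> real ^ 'n \<Rightarrow> real" where
  "b_star K x y = Sup {b. b > 0 \<and> (\<exists>a. \<forall>\<theta>\<in>{0..2 * pi}. ellipse a b x y \<theta> \<in> K)}"

definition extremal_quotient ::
    "(real ^ 'n) set \<Rightarrow> real ^ 'n \<Rightarrow> real ^ 'n \<Rightarrow> real \<Rightarrow> ereal" where
  "extremal_quotient K x y t =
     extremal_function K (cvec x + (\<i> * of_real t) *s cvec y) / ereal t"

definition delta_B :: "(real ^ 'n) set \<Rightarrow> real ^ 'n \<Rightarrow> real ^ 'n \<Rightarrow> ereal" where
  "delta_B K x y = Lim (at_right 0) (extremal_quotient K x y)"

end

theory Submission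
  imports Defs "HOL-Complex_Analysis.Complex_Analysis" "HOL-Real_Asymp.Real_Asymp"
begin

text \<open>Upper bound: an inscribed ellipse \<open>Z + cos \<theta> A - sin \<theta> B\<close> extends to the entire curve
  \<open>Z + cosh \<tau> A + \<i> sinh \<tau> B\<close>, along which every competitor is at most \<open>Re \<tau>\<close>. Shrinking an almost
  optimal ellipse towards \<open>x\<close> and translating it slightly makes the curve pass through
  \<open>x + \<i> t y\<close> at \<open>\<tau> = arsinh (t / b')\<close>.

  Lower bound: if affine functions \<open>l\<^sub>j\<close> are nonnegative on \<open>K\<close> and sum to 1, then
  \<open>arcosh (\<Sum>j. |l\<^sub>j|)\<close> is a competitor, and at \<open>x + \<i> t y\<close> it grows like \<open>t\<close> times the square root of
  \<open>\<Sum>j. d\<^sub>j\<^sup>2 / l\<^sub>j(x)\<close>, where \<open>d\<^sub>j\<close> is the derivative of \<open>l\<^sub>j\<close> in the direction \<open>y\<close>. The conditions on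
  \<open>a\<close> for an ellipse to lie in \<open>K\<close> are linear. If no \<open>a\<close> is admissible for a given \<open>b\<close>, a separating
  hyperplane therefore yields \<open>l\<^sub>j\<close> for which this sum is at least \<open>1 / b\<^sup>2\<close>.\<close>

section \<open>Integrals over circles and semicontinuity\<close>

lemma ereal_integral_mono:
  assumes "\<And>x. x \<in> space M \<Longrightarrow> f x \<le> g x"
  shows "ereal_integral M f \<le> ereal_integral M g"
  unfolding ereal_integral_def
  by (intro ereal_minus_mono; subst less_eq_ennreal.rep_eq[symmetric]; intro nn_integral_mono e2ennreal_mono)
     (use assms in auto)

lemma ereal_integral_eq_integral:
  fixes f :: "'a \<Rightarrow> real"
  assumes "integrable M f"
  shows "ereal_integral M (\<lambda>x. ereal (f x)) = ereal (integral\<^sup>L M f)"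
proof -
  have fin: "(\<integral>\<^sup>+ x. ennreal (f x) \<partial>M) \<noteq> \<infinity>" "(\<integral>\<^sup>+ x. ennreal (- f x) \<partial>M) \<noteq> \<infinity>"
    using assms unfolding real_integrable_def by auto
  show ?thesis
    using fin unfolding ereal_integral_def real_lebesgue_integral_def[OF assms] uminus_ereal.simps
    by (cases "\<integral>\<^sup>+ x. ennreal (f x) \<partial>M"; cases "\<integral>\<^sup>+ x. ennreal (- f x) \<partial>M")
       (simp_all add: e2ennreal_ereal)
qed

lemma ereal_integral_Icc:
  fixes f :: "real \<Rightarrow> real"
  assumes "continuous_on {a..b} f"
  shows "ereal_integral (restrict_space lborel {a..b}) (\<lambda>x. ereal (f x)) = ereal (integral {a..b} f)"
proof -
  have int: "set_integrable lborel {a..b} f"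
    by (rule borel_integrable_atLeastAtMost'[OF assms])
  have "integrable (restrict_space lborel {a..b}) f"
    using int unfolding set_integrable_def by (subst integrable_restrict_space) auto
  moreover have "integral\<^sup>L (restrict_space lborel {a..b}) f = (LINT x:{a..b}|lborel. f x)"
    unfolding set_lebesgue_integral_def by (subst integral_restrict_space) auto
  moreover have "(LINT x:{a..b}|lborel. f x) = integral {a..b} f"
    by (rule set_borel_integral_eq_integral(2)[OF int])
  ultimately show ?thesis by (simp add: ereal_integral_eq_integral)
qed

lemma circle_mean_real:
  assumes "continuous_on {0..2*pi} (\<lambda>\<theta>. v (c + of_real r * cis \<theta>))"
  shows "circle_mean (\<lambda>z. ereal (v z)) c r =
         ereal (integral {0..2*pi} (\<lambda>\<theta>. v (c + of_real r * cis \<theta>)) / (2 * pi))"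
  unfolding circle_mean_def ereal_integral_Icc[OF assms] by simp

text \<open>The sub-mean value inequality in usable form: the extended integral of \<open>v\<close>
  is never computed, only that of a continuous majorant.\<close>

lemma subharmonic_le_mean_majorant:
  assumes "subharmonic v" "r > 0" and cont: "continuous_on {0..2*pi} g"
    and le: "\<And>\<theta>. \<theta> \<in> {0..2*pi} \<Longrightarrow> v (c + of_real r * cis \<theta>) \<le> ereal (g \<theta>)"
  shows "v c \<le> ereal (integral {0..2*pi} g / (2*pi))"
proof -
  have "v c \<le> circle_mean v c r" using assms(1,2) by (auto simp: subharmonic_def)
  also have "\<dots> \<le> ereal_integral (restrict_space lborel {0..2 * pi}) (\<lambda>\<theta>. ereal (g \<theta>)) / ereal (2*pi)"
    unfolding circle_mean_def
    by (intro ereal_divide_right_mono ereal_integral_mono) (use le in auto)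
  also have "\<dots> = ereal (integral {0..2*pi} g / (2*pi))"
    unfolding ereal_integral_Icc[OF cont] by simp
  finally show ?thesis .
qed

text \<open>In Cauchy's integral formula the denominator \<open>u - c\<close> cancels the derivative
  of the circle up to the factor \<open>\<i>\<close>, which leaves the mean value property.\<close>

lemma has_integral_Re_holomorphic_circle:
  assumes "h holomorphic_on ball c R" "0 < r" "r < R"
  shows "((\<lambda>\<theta>. Re (h (c + of_real r * cis \<theta>))) has_integral 2 * pi * Re (h c)) {0..2*pi}"
proof -
  have hol: "h holomorphic_on cball c r"
    by (rule holomorphic_on_subset[OF assms(1)]) (use assms(3) in auto)
  have "((\<lambda>u. h u/(u-c)) has_contour_integral (2 * of_real pi * \<i> * h c)) (circlepath c r)"
    by (rule Cauchy_integral_circlepath)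
       (use hol assms in \<open>auto intro: holomorphic_on_imp_continuous_on holomorphic_on_subset\<close>)
  hence "((\<lambda>t. h (c + of_real r * cis t) / ((c + of_real r * cis t) - c) * of_real r * \<i> * cis t)
     has_integral (2 * of_real pi * \<i> * h c)) {0..2*pi}"
    unfolding circlepath_def by (subst (asm) has_contour_integral_part_circlepath_iff) auto
  hence "((\<lambda>t. h (c + of_real r * cis t) * \<i>) has_integral (2 * of_real pi * \<i> * h c)) {0..2*pi}"
    using assms(2) by (simp add: field_simps)
  from has_integral_mult_left[OF this, of "-\<i>"]
  have "((\<lambda>t. h (c + of_real r * cis t)) has_integral (2 * of_real pi * h c)) {0..2*pi}"
    by (simp add: algebra_simps)
  from has_integral_Re[OF this] show ?thesis by simp
qed

section \<open>Upper semicontinuous functions\<close>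

lemma usc_ereal_continuous:
  fixes f :: "'a::topological_space \<Rightarrow> real"
  assumes "continuous_on UNIV f" shows "usc (\<lambda>z. ereal (f z))"
  unfolding usc_def
proof
  fix c :: ereal
  show "open {z. ereal (f z) < c}"
    by (intro open_Collect_less continuous_on_ereal assms continuous_on_const)
qed

lemma usc_compose:
  assumes "usc u" "continuous_on UNIV g"
  shows "usc (\<lambda>p. u (g p))"
  unfolding usc_def
proof
  fix c
  have "open (g -` {z. u z < c})"
    by (rule open_vimage) (use assms in \<open>auto simp: usc_def\<close>)
  thus "open {p. u (g p) < c}" by (simp add: vimage_def)
qed

lemma usc_diff_real:
  fixes \<psi> :: "'a::topological_space \<Rightarrow> real"
  assumes "usc F" "continuous_on UNIV \<psi>"
  shows "usc (\<lambda>p. F p - ereal (\<psi> p))"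
  unfolding usc_def
proof
  fix c :: ereal
  \<comment> \<open>A real \<open>q\<close> strictly between \<open>F p\<close> and
    \<open>c + \<psi> p\<close> separates the two functions and exhibits the set as a union of open
    sets.\<close>
  have eq: "{p. F p - ereal (\<psi> p) < c} = (\<Union>q::real. {p. F p < ereal q} \<inter> {p. ereal (q - \<psi> p) < c})"
  proof (intro set_eqI iffI)
    fix p assume "p \<in> {p. F p - ereal (\<psi> p) < c}"
    hence "F p < c + ereal (\<psi> p)" by (simp add: ereal_minus_less)
    then obtain q where "F p < ereal q" "ereal q < c + ereal (\<psi> p)"
      using ereal_dense2 by blast
    thus "p \<in> (\<Union>q::real. {p. F p < ereal q} \<inter> {p. ereal (q - \<psi> p) < c})"
      by (cases c) auto
  next
    fix p assume "p \<in> (\<Union>q::real. {p. F p < ereal q} \<inter> {p. ereal (q - \<psi> p) < c})"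
    then obtain q where "F p < ereal q" "ereal (q - \<psi> p) < c" by auto
    thus "p \<in> {p. F p - ereal (\<psi> p) < c}" by (cases c; cases "F p") auto
  qed
  have "open {p. ereal (q - \<psi> p) < c}" for q
    by (intro open_Collect_less continuous_on_ereal continuous_intros assms)
  thus "open {p. F p - ereal (\<psi> p) < c}"
    unfolding eq using assms(1)[unfolded usc_def] by (intro open_UN ballI open_Int) blast+
qed

text \<open>Without a maximum the open sets \<open>{z. F z < F y}\<close> with \<open>y\<close> in
  \<open>S\<close> cover \<open>S\<close>; a finite subcover misses its own point of largest
  value.\<close>

lemma usc_attains_sup:
  assumes "usc F" "compact S" "S \<noteq> {}"
  obtains p where "p \<in> S" "\<And>q. q \<in> S \<Longrightarrow> F q \<le> F p"
proof (rule ccontr)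
  assume "\<not> thesis"
  with that have no: "\<exists>q\<in>S. F p < F q" if "p \<in> S" for p using that by (meson not_le)
  define U where "U y = {z. F z < F y}" for y
  have "S \<subseteq> (\<Union>y\<in>S. U y)" using no by (auto simp: U_def)
  moreover have "\<forall>y\<in>S. open (U y)" using assms(1) by (auto simp: usc_def U_def)
  ultimately obtain C where C: "C \<subseteq> S" "finite C" "S \<subseteq> (\<Union>y\<in>C. U y)"
    using compactE_image[OF assms(2), of S U] by metis
  hence "C \<noteq> {}" using assms(3) by auto
  then have "Max (F ` C) \<in> F ` C" using C(2) by simp
  then obtain y where "y \<in> C" "F y = Max (F ` C)" by auto
  hence y: "y \<in> C" "\<And>z. z \<in> C \<Longrightarrow> F z \<le> F y" using C(2) by auto
  moreover obtain z where "z \<in> C" "F y < F z" using C y(1) by (auto simp: U_def)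
  ultimately show False by fastforce
qed

section \<open>Upper bound along complexified ellipses\<close>

lemma Re_of_real_mult: "Re (of_real a * z) = a * Re z"
  by simp

lemma norm_vector_smult: "norm (a *s (v::complex^'n)) = cmod a * norm v"
  by (simp add: norm_vec_def L2_set_def norm_mult power_mult_distrib
      sum_distrib_left[symmetric] real_sqrt_mult)

text \<open>Shows that the real inner product depends on the scalar \<open>a\<close> as the real
  part of a complex linear function, hence harmonically.\<close>

lemma inner_vector_smult:
  "inner w (a *s (v::complex^'n)) = Re (a * (\<Sum>i\<in>UNIV. cnj (w $ i) * v $ i))"
  by (simp add: inner_vec_def inner_complex_def sum_distrib_left Re_sum algebra_simps sum.distrib
      sum_subtractf)

lemma continuous_on_vector_smult [continuous_intros]:
  fixes v :: "complex^'n"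
  assumes "continuous_on S g"
  shows "continuous_on S (\<lambda>x. g x *s v)"
  unfolding vector_scalar_mult_def
  by (intro continuous_on_vec_lambda continuous_intros assms)

lemma cmod_exp_minus_linear_le:
  assumes "cmod z \<le> 1"
  shows "cmod (exp z - 1 - z) \<le> 3 * (cmod z)\<^sup>2"
proof -
  have "cmod (exp z - 1 - z) \<le> exp \<bar>Re z\<bar> * (cmod z)\<^sup>2"
    using Taylor_exp[of z 1] by (simp add: algebra_simps power2_eq_square)
  also have "exp \<bar>Re z\<bar> \<le> exp 1" using abs_Re_le_cmod[of z] assms by simp
  also have "\<dots> \<le> 3" by (rule exp_le)
  finally show ?thesis by (simp add: mult_right_mono)
qed

lemma cmod_cosh_minus_1_le:
  assumes "cmod z \<le> 1"
  shows "cmod (cosh z - 1) \<le> 3 * (cmod z)\<^sup>2"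
proof -
  have "cosh z - 1 = ((exp z - 1 - z) + (exp (-z) - 1 - (-z))) / 2"
    by (simp add: cosh_field_def field_simps)
  also have "cmod \<dots> \<le> (cmod (exp z - 1 - z) + cmod (exp (-z) - 1 - (-z))) / 2"
    unfolding norm_divide norm_numeral by (intro divide_right_mono norm_triangle_ineq) simp
  finally show ?thesis
    using cmod_exp_minus_linear_le[of z] cmod_exp_minus_linear_le[of "-z"] assms by simp
qed

lemma cmod_sinh_minus_id_le:
  assumes "cmod z \<le> 1"
  shows "cmod (sinh z - z) \<le> 3 * (cmod z)\<^sup>2"
proof -
  have "sinh z - z = ((exp z - 1 - z) - (exp (-z) - 1 - (-z))) / 2"
    by (simp add: sinh_field_def field_simps)
  also have "cmod \<dots> \<le> (cmod (exp z - 1 - z) + cmod (exp (-z) - 1 - (-z))) / 2"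
    unfolding norm_divide norm_numeral by (intro divide_right_mono norm_triangle_ineq4) simp
  finally show ?thesis
    using cmod_exp_minus_linear_le[of z] cmod_exp_minus_linear_le[of "-z"] assms by simp
qed

lemma cmod_cosh_sinh_le:
  assumes "Re z \<ge> 0"
  shows "cmod (cosh z) \<le> exp (Re z)" "cmod (sinh z) \<le> exp (Re z)"
proof -
  have "exp (- Re z) \<le> exp (Re z)" using assms by simp
  hence "cmod (exp z) + cmod (exp (-z)) \<le> 2 * exp (Re z)" by simp
  moreover have "cmod (exp z + exp (-z)) \<le> cmod (exp z) + cmod (exp (-z))"
    "cmod (exp z - exp (-z)) \<le> cmod (exp z) + cmod (exp (-z))"
    by (rule norm_triangle_ineq norm_triangle_ineq4)+
  ultimately show "cmod (cosh z) \<le> exp (Re z)" "cmod (sinh z) \<le> exp (Re z)"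
    unfolding cosh_field_def sinh_field_def norm_divide norm_numeral by linarith+
qed

lemma lelong_class_psh: "u \<in> lelong_class \<Longrightarrow> plurisubharmonic u"
  by (simp add: lelong_class_def)

lemma log_plus_le:
  assumes "0 \<le> x" "x \<le> N * exp s" "1 \<le> N" "0 \<le> s"
  shows "log_plus x \<le> ln N + s"
proof (cases "x = 0")
  case False
  hence "ln x \<le> ln (N * exp s)" using assms by (subst ln_le_cancel_iff) auto
  also have "\<dots> = ln N + s" using assms by (subst ln_mult) auto
  finally show ?thesis using assms by (simp add: log_plus_def)
qed (use assms in \<open>simp add: log_plus_def\<close>)

text \<open>Plurisubharmonicity is only available along complex lines and \<^term>\<open>u\<close> is only upper
  semicontinuous, so composition with the curve \<open>f\<close> is avoided by doubling variables: one
  maximizes \<open>u (f \<tau> + w) - \<phi> \<tau> - k |w|\<^sup>2\<close>, where \<open>\<phi>\<close> is slightly larger than the real part and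
  strictly superharmonic. At an interior maximum the mean value inequality along the line through
  \<open>f \<tau> + w\<close> in the direction of the derivative of \<open>f\<close> costs only \<open>O(\<rho>^4)\<close>, which is less than
  the gain \<open>q \<rho>\<^sup>2 / 2\<close> from \<open>\<phi>\<close>.\<close>

lemma lelong_le_on_conic:
  fixes u :: "complex ^ 'n \<Rightarrow> ereal" and Z P Q :: "complex ^ 'n"
  defines "f \<equiv> \<lambda>\<tau>. Z + cosh \<tau> *s P + sinh \<tau> *s Q"
  assumes u: "u \<in> lelong_class"
    and le0: "\<And>\<theta>::real. u (f (\<i> * of_real \<theta>)) \<le> 0"
    and \<tau>0: "Re \<tau>0 \<ge> 0"
  shows "u (f \<tau>0) \<le> ereal (Re \<tau>0)"
proof (rule ccontr)
  assume "\<not> ?thesis"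
  hence gt: "u (f \<tau>0) > ereal (Re \<tau>0)" by simp
  have uscu: "usc u" and ufin: "\<And>z. u z < \<infinity>"
    and line: "\<And>z w. subharmonic (\<lambda>\<zeta>. u (z + \<zeta> *s w))"
    using lelong_class_psh[OF u] by (auto simp: plurisubharmonic_def)
  obtain c where c: "\<And>z. u z \<le> ereal (log_plus (norm z) + c)"
    using u by (auto simp: lelong_class_def)
  obtain \<mu> where \<mu>: "u (f \<tau>0) = ereal \<mu>" using gt ufin[of "f \<tau>0"] by (cases "u (f \<tau>0)") auto
  have \<mu>gt: "\<mu> > Re \<tau>0" using gt \<mu> by simp
  \<comment> \<open>\<open>N\<close> measures the growth of the curve: cosh and sinh are at most
    \<open>exp (Re \<tau>)\<close> in modulus, so |f \<tau> + w| is at most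
    \<open>N * exp (Re \<tau>)\<close>.\<close>
  define N where "N = norm Z + norm P + norm Q + 1"
  have N1: "N \<ge> 1" by (simp add: N_def)
  define L where "L = ln N + \<bar>c\<bar>"
  have L0: "L \<ge> 0" using N1 by (simp add: L_def)
  have growth: "u (f \<tau> + w) \<le> ereal (Re \<tau> + L)" if "Re \<tau> \<ge> 0" "norm w \<le> 1" for \<tau> w
  proof -
    have "norm (f \<tau> + w) \<le> norm Z + norm (cosh \<tau> *s P) + norm (sinh \<tau> *s Q) + norm w"
      unfolding f_def by norm
    also have "\<dots> \<le> norm Z * exp (Re \<tau>) + exp (Re \<tau>) * norm P + exp (Re \<tau>) * norm Q + 1 * exp (Re \<tau>)"
    proof (intro add_mono)
      have e1: "1 \<le> exp (Re \<tau>)" using that by simp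
      show "norm Z \<le> norm Z * exp (Re \<tau>)"
        using mult_left_mono[OF e1, of "norm Z"] by simp
      show "norm w \<le> 1 * exp (Re \<tau>)" using e1 that(2) by linarith
      show "norm (cosh \<tau> *s P) \<le> exp (Re \<tau>) * norm P" "norm (sinh \<tau> *s Q) \<le> exp (Re \<tau>) * norm Q"
        unfolding norm_vector_smult using cmod_cosh_sinh_le[OF that(1)]
        by (auto intro: mult_right_mono)
    qed
    also have "\<dots> = N * exp (Re \<tau>)" by (simp add: N_def algebra_simps)
    finally have "log_plus (norm (f \<tau> + w)) \<le> ln N + Re \<tau>"
      using N1 that by (intro log_plus_le) auto
    hence "log_plus (norm (f \<tau> + w)) + c \<le> Re \<tau> + L" by (simp add: L_def)
    thus ?thesis using c[of "f \<tau> + w"] by (meson ereal_less_eq(3) order_trans)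
  qed
  \<comment> \<open>Half of the excess of \<mu> over \<open>Re \<tau>0\<close> is spent, so that
    \<mu> still exceeds \<open>(1 + \<delta>) * Re \<tau>0 + \<delta>\<close>.\<close>
  define \<delta> where "\<delta> = (\<mu> - Re \<tau>0) / (2 * (Re \<tau>0 + 1))"
  have \<delta>0: "\<delta> > 0" using \<mu>gt \<tau>0 by (simp add: \<delta>_def)
  have "\<delta> * (Re \<tau>0 + 1) = (\<mu> - Re \<tau>0) / 2" using \<tau>0 by (simp add: \<delta>_def divide_simps)
  hence \<delta>: "\<mu> > (1 + \<delta>) * Re \<tau>0 + \<delta>" using \<mu>gt by (simp add: algebra_simps)
  \<comment> \<open>\<open>S\<close> is the right edge of the strip, placed where the surplus
    \<open>\<delta> * S / 2\<close> of \<phi> beats the constant \<open>L\<close> of the growth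
    bound.\<close>
  define S where "S = max (Re \<tau>0) (2 * (L + 1) / \<delta>)"
  have S: "S \<ge> Re \<tau>0" "\<delta> * S / 2 \<ge> L + 1" "S > 0"
  proof -
    show "S \<ge> Re \<tau>0" by (simp add: S_def)
    have "2 * (L + 1) / \<delta> \<le> S" by (simp add: S_def)
    moreover have "2 * (L + 1) / \<delta> > 0" using L0 \<delta>0 by simp
    ultimately show "S > 0" "\<delta> * S / 2 \<ge> L + 1" using \<delta>0 by (linarith, simp add: field_simps)
  qed
  \<comment> \<open>With \<open>q * S = \<delta> / 2\<close> the concave correction uses at most
    half of the surplus \<open>\<delta> * Re \<tau>\<close> on the strip, so \<phi> stays
    nonnegative.\<close>
  define q where "q = \<delta> / (2 * S)"
  have q0: "q > 0" using \<delta>0 S by (simp add: q_def)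
  have qS: "q * S = \<delta> / 2" using S by (simp add: q_def)
  define \<phi> where "\<phi> \<tau> = (1 + \<delta>) * Re \<tau> - q * (Re \<tau>)\<^sup>2" for \<tau>
  have \<phi>0: "\<phi> \<tau> \<ge> 0" if "0 \<le> Re \<tau>" "Re \<tau> \<le> S" for \<tau>
  proof -
    have "q * Re \<tau> \<le> \<delta> / 2" using mult_left_mono[OF that(2), of q] q0 qS by simp
    hence "q * Re \<tau> * Re \<tau> \<le> \<delta> * Re \<tau>" using that \<delta>0
      by (intro mult_right_mono) auto
    thus ?thesis using that by (simp add: \<phi>_def algebra_simps power2_eq_square)
  qed
  \<comment> \<open>Upper semicontinuity and compactness of the ellipse make the bound on the
    imaginary axis stable under small shifts \<open>w\<close>, uniformly in \<theta>.\<close>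
  have "\<exists>e\<in>{0<..1}. \<forall>\<theta>\<in>{0..2*pi}. \<forall>w. norm w < e \<longrightarrow> u (f (\<i> * of_real \<theta>) + w) < ereal \<delta>"
  proof -
    define E where "E = (\<lambda>\<theta>::real. f (\<i> * of_real \<theta>)) ` {0..2*pi}"
    have "compact E" unfolding E_def f_def
      by (intro compact_continuous_image continuous_intros compact_Icc)
    moreover have "E \<subseteq> {z. u z < ereal \<delta>}"
      unfolding E_def using le0 \<delta>0 by (auto intro!: le_less_trans[OF le0])
    moreover have "open {z. u z < ereal \<delta>}" using uscu by (auto simp: usc_def)
    ultimately obtain e where e: "e > 0" "(\<Union>x\<in>E. ball x e) \<subseteq> {z. u z < ereal \<delta>}"
      using compact_subset_open_imp_ball_epsilon_subset by metis
    show ?thesis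
    proof (rule bexI[of _ "min 1 e"]; (intro ballI allI impI)?)
      fix \<theta> :: real and w :: "complex^'n" assume "\<theta> \<in> {0..2*pi}" "norm w < min 1 e"
      hence "f (\<i> * of_real \<theta>) + w \<in> (\<Union>x\<in>E. ball x e)"
        by (auto simp: E_def dist_norm intro!: bexI[of _ \<theta>])
      thus "u (f (\<i> * of_real \<theta>) + w) < ereal \<delta>" using e(2) by blast
    qed (use e in auto)
  qed
  then obtain e where e: "0 < e" "e \<le> 1" and
    small: "\<And>\<theta> w. \<theta> \<in> {0..2*pi} \<Longrightarrow> norm w < e \<Longrightarrow> u (f (\<i> * of_real \<theta>) + w) < ereal \<delta>"
    by auto
  \<comment> \<open>The penalty at |w| = e equals \<open>S + L\<close>, the most that the growth
    bound allows; this forces \<open>norm w < e\<close> at the maximum.\<close>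
  define k where "k = (S + L) / e\<^sup>2"
  have k0: "k > 0" using S L0 e by (simp add: k_def)
  define \<Phi> where "\<Phi> = (\<lambda>p. u (f (snd p) + fst p) - ereal (\<phi> (snd p) + k * (norm (fst p))\<^sup>2))"
  \<comment> \<open>Since \<open>f\<close> has period \<open>2 * pi * \<i>\<close>, one period
    represents the whole strip and gives a compact domain.\<close>
  define X where "X = cball (0::complex^'n) 1 \<times> cbox 0 (Complex S (2*pi))"
  have "usc \<Phi>" unfolding \<Phi>_def \<phi>_def f_def
    by (rule usc_diff_real[OF usc_compose[OF uscu]]; intro continuous_intros)
  moreover have "compact X" unfolding X_def by (intro compact_Times compact_cball compact_cbox)
  moreover have "(0, 0) \<in> X" using S by (auto simp: X_def in_cbox_complex_iff)
  ultimately obtain p where p: "p \<in> X" "\<And>p'. p' \<in> X \<Longrightarrow> \<Phi> p' \<le> \<Phi> p"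
    using usc_attains_sup[of \<Phi> X] by blast
  obtain w \<tau> where w\<tau>: "p = (w, \<tau>)" by (cases p)
  have periodic: "\<exists>\<tau>'\<in>cbox 0 (Complex S (2*pi)). f \<tau>' = f \<sigma> \<and> Re \<tau>' = Re \<sigma>"
    if "0 \<le> Re \<sigma>" "Re \<sigma> \<le> S" for \<sigma>
  proof -
    define n where "n = \<lfloor>Im \<sigma> / (2*pi)\<rfloor>"
    have n: "of_int n \<le> Im \<sigma> / (2*pi)" "Im \<sigma> / (2*pi) < of_int n + 1"
      unfolding n_def by linarith+
    define \<tau>' where "\<tau>' = \<sigma> + (of_int (2 * (-n)) * pi) * \<i>"
    have ex: "exp \<tau>' = exp \<sigma>" unfolding \<tau>'_def by (subst exp_eq) blast
    hence "f \<tau>' = f \<sigma>" by (simp add: f_def cosh_field_def sinh_field_def exp_minus)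
    moreover have "\<tau>' \<in> cbox 0 (Complex S (2*pi))"
      using that n by (auto simp: \<tau>'_def in_cbox_complex_iff field_simps)
    ultimately show ?thesis by (auto simp: \<tau>'_def intro!: bexI[of _ \<tau>'])
  qed
  have max: "\<Phi> (w', \<sigma>) \<le> \<Phi> p" if r: "0 \<le> Re \<sigma>" "Re \<sigma> \<le> S" "norm w' \<le> 1" for w' \<sigma>
  proof -
    obtain \<tau>' where t: "\<tau>'\<in>cbox 0 (Complex S (2*pi))" "f \<tau>' = f \<sigma>" "Re \<tau>' = Re \<sigma>"
      using periodic[OF r(1,2)] by blast
    hence "\<Phi> (w', \<sigma>) = \<Phi> (w', \<tau>')" by (simp add: \<Phi>_def \<phi>_def)
    also have "\<dots> \<le> \<Phi> p" using t r by (intro p) (auto simp: X_def)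
    finally show ?thesis .
  qed
  have "ereal \<delta> < \<Phi> (0, \<tau>0)"
  proof -
    have "\<phi> \<tau>0 \<le> (1 + \<delta>) * Re \<tau>0" using q0 by (simp add: \<phi>_def)
    thus ?thesis using \<delta> by (simp add: \<Phi>_def \<mu>)
  qed
  also have "\<dots> \<le> \<Phi> p" using \<tau>0 S by (intro max) auto
  finally have \<Phi>p: "ereal \<delta> < \<Phi> p" .
  have w1: "norm w \<le> 1" and \<tau>S: "0 \<le> Re \<tau>" "Re \<tau> \<le> S" and \<tau>I: "0 \<le> Im \<tau>" "Im \<tau> \<le> 2*pi"
    using p(1) by (auto simp: X_def w\<tau> in_cbox_complex_iff)
  define m where "m = real_of_ereal (u (f \<tau> + w)) - (\<phi> \<tau> + k * (norm w)\<^sup>2)"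
  have uw: "u (f \<tau> + w) = ereal (m + \<phi> \<tau> + k * (norm w)\<^sup>2)" and m: "\<Phi> p = ereal m"
  proof -
    have "u (f \<tau> + w) \<noteq> -\<infinity>" using \<Phi>p by (auto simp: \<Phi>_def w\<tau>)
    then obtain r where "u (f \<tau> + w) = ereal r" using ufin[of "f \<tau> + w"] by (cases "u (f \<tau> + w)") auto
    thus "u (f \<tau> + w) = ereal (m + \<phi> \<tau> + k * (norm w)\<^sup>2)" "\<Phi> p = ereal m"
      by (auto simp: m_def \<Phi>_def w\<tau>)
  qed
  have m\<delta>: "m > \<delta>" using \<Phi>p m by simp
  have kw: "m + \<phi> \<tau> + k * (norm w)\<^sup>2 \<le> Re \<tau> + L" using growth[OF \<tau>S(1) w1] uw by simp
  have we: "norm w < e"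
  proof -
    have "k * (norm w)\<^sup>2 < S + L" using kw m\<delta> \<delta>0 \<phi>0[OF \<tau>S] \<tau>S by linarith
    also have "\<dots> = k * e\<^sup>2" using e by (simp add: k_def)
    finally have "(norm w)\<^sup>2 < e\<^sup>2" using k0 by simp
    thus ?thesis using e by (simp add: power2_less_imp_less)
  qed
  \<comment> \<open>The right edge is excluded by the growth bound, the left edge by the bound
    \<delta> near the ellipse; both contradict \<open>m > \<delta>\<close>.\<close>
  have "Re \<tau> \<noteq> S"
  proof
    assume eq: "Re \<tau> = S"
    have "\<phi> \<tau> = S + \<delta> * S / 2" unfolding \<phi>_def eq power2_eq_square mult.assoc[symmetric] qS
      by (simp add: algebra_simps)
    moreover have "k * (norm w)\<^sup>2 \<ge> 0" using k0 by simp
    ultimately show False using kw S m\<delta> \<delta>0 eq by linarith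
  qed
  moreover have "Re \<tau> \<noteq> 0"
  proof
    assume eq: "Re \<tau> = 0"
    hence \<tau>eq: "\<tau> = \<i> * of_real (Im \<tau>)" by (simp add: complex_eq_iff)
    have "u (f \<tau> + w) < ereal \<delta>" using small[of "Im \<tau>" w] \<tau>I we \<tau>eq by auto
    moreover have "k * (norm w)\<^sup>2 \<ge> 0" using k0 by simp
    ultimately show False using uw m\<delta> eq by (simp add: \<phi>_def)
  qed
  ultimately have \<tau>S': "0 < Re \<tau>" "Re \<tau> < S" using \<tau>S by auto
  \<comment> \<open>\<open>D\<close> and \<open>R\<close> are the first and second derivatives of
    \<open>f\<close> at \<tau>; \<open>g\<close> is the remainder of the first order
    expansion.\<close>
  define D where "D = sinh \<tau> *s P + cosh \<tau> *s Q"
  define R where "R = cosh \<tau> *s P + sinh \<tau> *s Q"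
  define g where "g \<eta> = (cosh \<eta> - 1) *s R + (sinh \<eta> - \<eta>) *s D" for \<eta>
  have fg: "f (\<tau> + \<eta>) = f \<tau> + \<eta> *s D + g \<eta>" for \<eta>
    by (simp add: f_def g_def D_def R_def cosh_add sinh_add vec_eq_iff algebra_simps)
  define B where "B = 3 * (norm R + norm D) + 1"
  have B1: "B \<ge> 1" by (simp add: B_def)
  have gB: "norm (g \<eta>) \<le> B * (cmod \<eta>)\<^sup>2" if "cmod \<eta> \<le> 1" for \<eta>
  proof -
    have "norm (g \<eta>) \<le> cmod (cosh \<eta> - 1) * norm R + cmod (sinh \<eta> - \<eta>) * norm D"
      unfolding g_def norm_vector_smult[symmetric] by (rule norm_triangle_ineq)
    also have "\<dots> \<le> 3 * (cmod \<eta>)\<^sup>2 * norm R + 3 * (cmod \<eta>)\<^sup>2 * norm D"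
      using cmod_cosh_minus_1_le[OF that] cmod_sinh_minus_id_le[OF that]
      by (intro add_mono mult_right_mono) auto
    also have "\<dots> \<le> B * (cmod \<eta>)\<^sup>2" by (simp add: B_def algebra_simps)
    finally show ?thesis .
  qed
  \<comment> \<open>The bounds keep the disc in the strip and \<open>w - g \<eta>\<close> in the
    unit ball, make the estimate of \<open>g\<close> applicable, and put the error
    \<open>k * B\<^sup>2 * \<rho>^4\<close> below the gain
    \<open>q * \<rho>\<^sup>2 / 2\<close>.\<close>
  define \<rho> where "\<rho> = Min {Re \<tau>, S - Re \<tau>, (1 - norm w) / B, 1, sqrt (q / (4 * k * B\<^sup>2))}"
  have \<rho>0: "\<rho> > 0" unfolding \<rho>_def using \<tau>S' we e B1 q0 k0 by auto
  have "\<rho> \<le> Re \<tau>" "\<rho> \<le> S - Re \<tau>" "\<rho> \<le> (1 - norm w) / B" and \<rho>1: "\<rho> \<le> 1"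
    and "\<rho> \<le> sqrt (q / (4 * k * B\<^sup>2))"
    unfolding \<rho>_def by (rule Min_le; simp)+
  note \<rho> = this
  have \<rho>w: "norm w + B * \<rho>\<^sup>2 \<le> 1"
  proof -
    have "\<rho>\<^sup>2 \<le> \<rho>" using \<rho>0 \<rho>1 by (simp add: power2_eq_square mult_left_le)
    hence "B * \<rho>\<^sup>2 \<le> B * \<rho>" using B1 by simp
    also have "\<dots> \<le> 1 - norm w" using \<rho>(3) B1 by (simp add: field_simps)
    finally show ?thesis by simp
  qed
  have \<rho>q: "k * B\<^sup>2 * \<rho>^4 < q * \<rho>\<^sup>2 / 2"
  proof -
    have "\<rho>\<^sup>2 \<le> q / (4 * k * B\<^sup>2)"
      using power_mono[OF \<rho>(5), of 2] \<rho>0 q0 k0 by simp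
    hence "k * B\<^sup>2 * \<rho>\<^sup>2 \<le> q / 4" using k0 B1 by (simp add: field_simps)
    hence "k * B\<^sup>2 * \<rho>\<^sup>2 * \<rho>\<^sup>2 \<le> q / 4 * \<rho>\<^sup>2" by (rule mult_right_mono) simp
    also have "\<dots> < q * \<rho>\<^sup>2 / 2" using q0 \<rho>0 by simp
    finally show ?thesis by (simp add: power_numeral_reduce power2_eq_square mult_ac)
  qed
  \<comment> \<open>\<open>a\<close> is the slope of \<phi> at \<tau>. \<open>h\<close> collects the
    part of the majorant that is the real part of a holomorphic function vanishing at 0, so its mean
    is 0; \<open>C\<close> collects the constants.\<close>
  define \<alpha> where "\<alpha> = (\<Sum>i\<in>UNIV. cnj (w $ i) * R $ i)"
  define \<beta> where "\<beta> = (\<Sum>i\<in>UNIV. cnj (w $ i) * D $ i)"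
  define a where "a = 1 + \<delta> - 2 * q * Re \<tau>"
  define h where "h \<eta> = of_real a * \<eta> - of_real (q/2) * \<eta>\<^sup>2
     - of_real (2 * k) * ((cosh \<eta> - 1) * \<alpha> + (sinh \<eta> - \<eta>) * \<beta>)" for \<eta>
  define C where "C = m + \<phi> \<tau> - q * \<rho>\<^sup>2 / 2 + k * (norm w)\<^sup>2 + k * B\<^sup>2 * \<rho>^4"
  have hol: "h holomorphic_on UNIV"
    unfolding h_def cosh_field_def sinh_field_def by (intro holomorphic_intros) auto
  have int: "((\<lambda>\<theta>. Re (h (0 + of_real \<rho> * cis \<theta>))) has_integral 2 * pi * Re (h 0)) {0..2*pi}"
    by (rule has_integral_Re_holomorphic_circle[where R="\<rho>+1"])
       (use \<rho>0 hol holomorphic_on_subset in auto)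
  have "u (f \<tau> + w + 0 *s D) \<le>
      ereal (integral {0..2*pi} (\<lambda>\<theta>. C + Re (h (0 + of_real \<rho> * cis \<theta>))) / (2*pi))"
  proof (rule subharmonic_le_mean_majorant[OF line \<rho>0])
    show "continuous_on {0..2*pi} (\<lambda>\<theta>. C + Re (h (0 + of_real \<rho> * cis \<theta>)))"
      unfolding h_def by (intro continuous_intros)
    fix \<theta> :: real
    define \<eta> where "\<eta> = 0 + of_real \<rho> * cis \<theta>"
    have c\<eta>: "cmod \<eta> = \<rho>" using \<rho>0 by (simp add: \<eta>_def norm_mult)
    have Re\<eta>: "\<bar>Re \<eta>\<bar> \<le> \<rho>" using abs_Re_le_cmod[of \<eta>] c\<eta> by simp
    have gr: "norm (g \<eta>) \<le> B * \<rho>\<^sup>2" using gB[of \<eta>] c\<eta> \<rho>1 by simp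
    \<comment> \<open>The second variable absorbs the curvature: the shift
      \<open>w - g \<eta>\<close> at \<open>\<tau> + \<eta>\<close> moves the argument of
      \<open>u\<close> exactly onto the complex line in direction \<open>D\<close>.\<close>
    have "norm (w - g \<eta>) \<le> 1" using norm_triangle_ineq4[of w "g \<eta>"] gr \<rho>w by linarith
    hence "\<Phi> (w - g \<eta>, \<tau> + \<eta>) \<le> ereal m"
      unfolding m[symmetric] using Re\<eta> \<rho> by (intro max) auto
    hence "u (f (\<tau> + \<eta>) + (w - g \<eta>)) \<le> ereal (m + (\<phi> (\<tau> + \<eta>) + k * (norm (w - g \<eta>))\<^sup>2))"
      by (simp add: \<Phi>_def ereal_minus_le add.commute)
    also have "f (\<tau> + \<eta>) + (w - g \<eta>) = f \<tau> + w + \<eta> *s D" by (simp add: fg)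
    also have "m + (\<phi> (\<tau> + \<eta>) + k * (norm (w - g \<eta>))\<^sup>2) \<le> C + Re (h \<eta>)"
    proof -
      have "w \<bullet> g \<eta> = Re ((cosh \<eta> - 1) * \<alpha> + (sinh \<eta> - \<eta>) * \<beta>)"
        by (simp only: g_def inner_add_right inner_vector_smult \<alpha>_def \<beta>_def plus_complex.sel)
      moreover have "(norm (w - g \<eta>))\<^sup>2 = (norm w)\<^sup>2 - 2 * (w \<bullet> g \<eta>) + (norm (g \<eta>))\<^sup>2"
        by (simp add: power2_norm_eq_inner inner_diff inner_commute algebra_simps)
      moreover have "(norm (g \<eta>))\<^sup>2 \<le> B\<^sup>2 * \<rho>^4"
        using power_mono[OF gr, of 2] by (simp add: power_mult_distrib flip: power_mult)
      ultimately have "k * (norm (w - g \<eta>))\<^sup>2 \<le>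
         k * ((norm w)\<^sup>2 - 2 * Re ((cosh \<eta> - 1) * \<alpha> + (sinh \<eta> - \<eta>) * \<beta>) + B\<^sup>2 * \<rho>^4)"
        using k0 by (intro mult_left_mono) auto
      hence 1: "k * (norm (w - g \<eta>))\<^sup>2 \<le> k * (norm w)\<^sup>2 + k * B\<^sup>2 * \<rho>^4
          - 2 * k * Re ((cosh \<eta> - 1) * \<alpha> + (sinh \<eta> - \<eta>) * \<beta>)"
        by (simp only: algebra_simps)
      \<comment> \<open>On this circle the square of \<open>Re \<eta>\<close> is a constant plus the
        harmonic term \<open>Re (\<eta>\<^sup>2) / 2\<close>; the constant is the gain.\<close>
      have "(Re \<eta>)\<^sup>2 + (Im \<eta>)\<^sup>2 = \<rho>\<^sup>2" using c\<eta> by (metis cmod_power2)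
      hence "q * (Re \<eta>)\<^sup>2 = q * ((\<rho>\<^sup>2 + Re (\<eta>\<^sup>2)) / 2)" by (simp add: Re_power2)
      moreover have "\<phi> (\<tau> + \<eta>) = \<phi> \<tau> + a * Re \<eta> - q * (Re \<eta>)\<^sup>2"
        by (simp add: \<phi>_def a_def algebra_simps power2_eq_square)
      ultimately have 2: "\<phi> (\<tau> + \<eta>) = \<phi> \<tau> + a * Re \<eta> - q / 2 * Re (\<eta>\<^sup>2) - q * \<rho>\<^sup>2 / 2"
        by (simp add: algebra_simps)
      have 3: "Re (h \<eta>) = a * Re \<eta> - q / 2 * Re (\<eta>\<^sup>2)
          - 2 * k * Re ((cosh \<eta> - 1) * \<alpha> + (sinh \<eta> - \<eta>) * \<beta>)"
        unfolding h_def minus_complex.sel by (simp only: Re_of_real_mult)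
      show ?thesis using 1 2 3 unfolding C_def by linarith
    qed
    finally show "u (f \<tau> + w + (0 + of_real \<rho> * cis \<theta>) *s D) \<le> ereal (C + Re (h (0 + of_real \<rho> * cis \<theta>)))"
      by (simp add: \<eta>_def)
  qed
  also have "integral {0..2*pi} (\<lambda>\<theta>. C + Re (h (0 + of_real \<rho> * cis \<theta>))) = 2 * pi * C"
    using has_integral_add[OF has_integral_const_real[of C 0 "2*pi"] int]
    by (intro integral_unique) (simp add: h_def)
  finally have "m + \<phi> \<tau> + k * (norm w)\<^sup>2 \<le> C" using uw by simp
  thus False using \<rho>q unfolding C_def by linarith
qed

section \<open>Subharmonicity from local holomorphic minorants\<close>

text \<open>Stone-Weierstrass applies: on the unit circle the conjugate of \<open>x\<close> is its
  inverse, so a product of real parts of monomials is a sum of such real parts and the class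
  \<open>P\<close> is an algebra.\<close>

lemma circle_approx_Re_poly:
  fixes v :: "complex \<Rightarrow> real"
  assumes "continuous_on (sphere 0 1) v" "e > 0"
  shows "\<exists>p. \<forall>\<zeta>\<in>sphere 0 1. \<bar>v \<zeta> - Re (poly p \<zeta>)\<bar> < e"
proof -
  define P where "P f \<longleftrightarrow> (\<exists>p. \<forall>\<zeta>\<in>sphere 0 1. f \<zeta> = Re (poly p \<zeta>))" for f :: "complex \<Rightarrow> real"
  have add: "P (\<lambda>x. f x + g x)" if "P f" "P g" for f g
  proof -
    obtain p q where "\<forall>\<zeta>\<in>sphere 0 1. f \<zeta> = Re (poly p \<zeta>)" "\<forall>\<zeta>\<in>sphere 0 1. g \<zeta> = Re (poly q \<zeta>)"
      using \<open>P f\<close> \<open>P g\<close> unfolding P_def by blast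
    thus ?thesis unfolding P_def by (intro exI[of _ "p + q"]) simp
  qed
  have const: "P (\<lambda>_. c)" for c
    unfolding P_def by (intro exI[of _ "[:of_real c:]"]) simp
  have sums: "P (\<lambda>x. \<Sum>i\<in>I. f i x)" if "finite I" "\<And>i. i \<in> I \<Longrightarrow> P (f i)" for I :: "nat set" and f
    using that by (induction I) (auto intro: add const)
  have cong: "P f" if "P g" "\<And>\<zeta>. \<zeta> \<in> sphere 0 1 \<Longrightarrow> f \<zeta> = g \<zeta>" for f g
    using that unfolding P_def by (metis (no_types, lifting))
  have monomial: "P (\<lambda>x. Re (c * x ^ n))" for c n
    unfolding P_def by (intro exI[of _ "monom c n"]) (simp add: poly_monom)
  have monomial_mult: "P (\<lambda>x. Re (a * x ^ i) * Re (b * x ^ j))" for a b i j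
  proof -
    have *: "P (\<lambda>x. Re (a * x ^ i * cnj (b * x ^ j)))" if "j \<le> i" for a b i j
    proof (rule cong[OF monomial[of "a * cnj b" "i - j"]])
      fix x :: complex assume "x \<in> sphere 0 1"
      hence "x * cnj x = 1" by (simp add: complex_norm_square[symmetric])
      hence "x ^ j * cnj x ^ j = 1" by (metis power_mult_distrib power_one)
      moreover have "x ^ i = x ^ (i - j) * x ^ j" using that by (simp flip: power_add)
      ultimately have "a * x ^ i * cnj (b * x ^ j) = a * cnj b * x ^ (i - j)"
        by (simp add: mult_ac)
      thus "Re (a * x ^ i * cnj (b * x ^ j)) = Re (a * cnj b * x ^ (i - j))" by (rule arg_cong)
    qed
    have **: "P (\<lambda>x. Re (a * x ^ i * cnj (b * x ^ j)))" for a b i j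
    proof (cases "j \<le> i")
      case False
      hence "P (\<lambda>x. Re (b * x ^ j * cnj (a * x ^ i)))" by (intro *) simp
      moreover have "Re (u * cnj v) = Re (v * cnj u)" for u v by simp
      ultimately show ?thesis by (rule cong)
    qed (rule *)
    have "P (\<lambda>x. Re (a * b / 2 * x ^ (i + j)) + Re (a / 2 * x ^ i * cnj (b * x ^ j)))"
      by (intro add monomial **)
    thus ?thesis
    proof (rule cong)
      fix x :: complex
      have "Re u * Re v = Re (u * v / 2) + Re (u * cnj v / 2)" for u v by (simp add: field_simps)
      from this[of "a * x ^ i" "b * x ^ j"]
      show "Re (a * x ^ i) * Re (b * x ^ j) = 
        Re (a * b / 2 * x ^ (i + j)) + Re (a / 2 * x ^ i * cnj (b * x ^ j))"
        by (simp only: power_add) (simp add: mult_ac)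
    qed
  qed
  have mult: "P (\<lambda>x. f x * g x)" if "P f" "P g" for f g
  proof -
    obtain p q where pq: "\<forall>\<zeta>\<in>sphere 0 1. f \<zeta> = Re (poly p \<zeta>)" "\<forall>\<zeta>\<in>sphere 0 1. g \<zeta> = Re (poly q \<zeta>)"
      using \<open>P f\<close> \<open>P g\<close> unfolding P_def by blast
    have "P (\<lambda>x. \<Sum>i\<le>degree p. \<Sum>j\<le>degree q. Re (coeff p i * x ^ i) * Re (coeff q j * x ^ j))"
      by (intro sums monomial_mult) auto
    thus ?thesis
      by (rule cong) (use pq in \<open>simp add: poly_altdef sum_product\<close>)
  qed
  have "\<exists>g. P g \<and> (\<forall>x\<in>sphere 0 1. \<bar>v x - g x\<bar> < e)"
  proof (rule Stone_Weierstrass_HOL[of "sphere 0 1" P])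
    show "continuous_on (sphere 0 1) f" if f: "P f" for f
    proof -
      obtain p where "\<forall>\<zeta>\<in>sphere 0 1. f \<zeta> = Re (poly p \<zeta>)" using f unfolding P_def by blast
      thus ?thesis by (subst continuous_on_cong[OF refl, of _ _ "\<lambda>\<zeta>. Re (poly p \<zeta>)"])
         (auto intro!: continuous_intros)
    qed
    show "\<exists>f. P f \<and> f x \<noteq> f y" if "x \<in> sphere 0 1 \<and> y \<in> sphere 0 1 \<and> x \<noteq> y" for x y :: complex
    proof (cases "Re x = Re y")
      case False
      thus ?thesis using monomial[of 1 1] by (intro exI[of _ Re]) simp
    next
      case True
      hence "Im x \<noteq> Im y" using that complex_eqI by blast
      thus ?thesis using monomial[of "-\<i>" 1] by (intro exI[of _ Im]) simp
    qed
  qed (use assms add mult const in auto)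
  then obtain g where g: "P g" "\<forall>x\<in>sphere 0 1. \<bar>v x - g x\<bar> < e" by blast
  then obtain p where "\<forall>\<zeta>\<in>sphere 0 1. g \<zeta> = Re (poly p \<zeta>)" unfolding P_def by blast
  thus ?thesis using g(2) by (intro exI[of _ p]) simp
qed

context
  fixes v :: "complex \<Rightarrow> real"
  assumes cont: "continuous_on UNIV v"
    and minorant: "\<And>z. \<exists>r>0. \<exists>F. F holomorphic_on ball z r \<and> Re (F z) = v z \<and>
                       (\<forall>w\<in>ball z r. Re (F w) \<le> v w)"
begin

text \<open>If the bound failed at \<open>c\<close>, adding a small multiple of |\<zeta> - c|^2
  would keep the maximum of \<open>v - Re p\<close> inside the disc, where the holomorphic minorant
  contradicts the mean value property.\<close>

lemma max_principle_local_minorants: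
  assumes p: "p holomorphic_on UNIV" and r: "r > 0"
    and le: "\<And>\<zeta>. \<zeta> \<in> sphere c r \<Longrightarrow> v \<zeta> \<le> Re (p \<zeta>) + e"
  shows "v c \<le> Re (p c) + e"
proof (rule ccontr)
  define \<gamma> where "\<gamma> = v c - Re (p c) - e"
  assume "\<not> v c \<le> Re (p c) + e"
  hence \<gamma>: "\<gamma> > 0" by (simp add: \<gamma>_def)
  \<comment> \<open>The quadratic term adds only half of the excess \<gamma> on the boundary circle,
    so the boundary stays below the value at \<open>c\<close>.\<close>
  define \<delta> where "\<delta> = \<gamma> / (2 * r\<^sup>2)"
  have \<delta>: "\<delta> > 0" "\<delta> * r\<^sup>2 = \<gamma> / 2" using \<gamma> r by (auto simp: \<delta>_def)
  define W where "W \<zeta> = v \<zeta> - Re (p \<zeta>) + \<delta> * (cmod (\<zeta> - c))\<^sup>2" for \<zeta>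
  have "continuous_on (cball c r) W"
    unfolding W_def
    by (intro continuous_intros continuous_on_subset[OF cont] holomorphic_on_imp_continuous_on
        holomorphic_on_subset[OF p]) auto
  then obtain z where z: "z \<in> cball c r" "\<And>\<zeta>. \<zeta> \<in> cball c r \<Longrightarrow> W \<zeta> \<le> W z"
    using continuous_attains_sup[of "cball c r" W] r by auto
  have "z \<notin> sphere c r"
  proof
    assume zs: "z \<in> sphere c r"
    hence "W z \<le> e + \<delta> * r\<^sup>2" using le[OF zs] by (simp add: W_def dist_norm norm_minus_commute)
    moreover have "W c = e + \<gamma>" by (simp add: W_def \<gamma>_def)
    moreover have "W c \<le> W z" using r by (intro z) auto
    ultimately show False using \<delta> \<gamma> by simp
  qed
  hence zb: "dist c z < r" using z(1) by auto
  obtain R F where R: "R > 0" and F: "F holomorphic_on ball z R" "Re (F z) = v z"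
    "\<And>w. w \<in> ball z R \<Longrightarrow> Re (F w) \<le> v w"
    using minorant[of z] by blast
  define \<rho> where "\<rho> = min (R / 2) (r - dist c z)"
  have \<rho>: "0 < \<rho>" "\<rho> < R" "\<rho> \<le> r - dist c z" using R zb by (auto simp: \<rho>_def)
  \<comment> \<open>The real part of the last summand is the linear part of
    \<open>\<delta> * (cmod (\<zeta> - c))\<^sup>2\<close> at \<open>z\<close>; the rest of the
    square is the strict gain \<open>\<delta> * \<rho>\<^sup>2\<close>.\<close>
  define h where "h \<zeta> = F \<zeta> - p \<zeta> + of_real (2 * \<delta>) * cnj (z - c) * (\<zeta> - z)" for \<zeta>
  have hol: "h holomorphic_on ball z R"
    unfolding h_def by (intro holomorphic_intros F holomorphic_on_subset[OF p]) auto
  have "2 * pi * Re (h z) \<le> (2 * pi - 0) * (Re (h z) - \<delta> * \<rho>\<^sup>2)"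
  proof (rule has_integral_le[OF has_integral_Re_holomorphic_circle[OF hol \<rho>(1,2)]])
    show "((\<lambda>_. Re (h z) - \<delta> * \<rho>\<^sup>2) has_integral (2 * pi - 0) * (Re (h z) - \<delta> * \<rho>\<^sup>2)) {0..2*pi}"
      using has_integral_const_real[of "Re (h z) - \<delta> * \<rho>\<^sup>2" 0 "2*pi"] by simp
    fix \<theta> :: real
    define \<eta> where "\<eta> = of_real \<rho> * cis \<theta>"
    have \<eta>: "cmod \<eta> = \<rho>" using \<rho> by (simp add: \<eta>_def norm_mult)
    have "dist c (z + \<eta>) \<le> dist c z + dist z (z + \<eta>)" by (rule dist_triangle)
    hence "dist c (z + \<eta>) \<le> r" using \<eta> \<rho>(3) by (simp add: dist_norm)
    hence "W (z + \<eta>) \<le> W z" by (intro z) simp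
    moreover have "Re (F (z + \<eta>)) \<le> v (z + \<eta>)" using \<eta> \<rho> by (intro F) (auto simp: dist_norm)
    moreover have "(cmod (z + \<eta> - c))\<^sup>2 = (cmod (z - c))\<^sup>2 + 2 * Re (cnj (z - c) * \<eta>) + \<rho>\<^sup>2"
      unfolding \<eta>[symmetric] cmod_power2 by (simp add: algebra_simps power2_eq_square)
    hence "\<delta> * (cmod (z + \<eta> - c))\<^sup>2 = \<delta> * (cmod (z - c))\<^sup>2 + Re (of_real (2 * \<delta>) * cnj (z - c) * \<eta>) + \<delta> * \<rho>\<^sup>2"
      by (simp only: mult.assoc Re_of_real_mult) (simp only: algebra_simps)
    ultimately show "Re (h (z + of_real \<rho> * cis \<theta>)) \<le> Re (h z) - \<delta> * \<rho>\<^sup>2"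
      unfolding W_def h_def \<eta>_def[symmetric] using F(2) by simp
  qed
  hence "pi * (\<delta> * \<rho>\<^sup>2) \<le> 0" by (simp add: algebra_simps)
  moreover have "pi * (\<delta> * \<rho>\<^sup>2) > 0" using \<delta>(1) \<rho>(1) by simp
  ultimately show False by simp
qed

text \<open>The local hypothesis yields the mean value inequality on every circle by comparison with
  real parts of polynomials, which approximate \<^term>\<open>v\<close> uniformly on the circle.\<close>

lemma subharmonic_of_local_minorants: "subharmonic (\<lambda>z. ereal (v z))"
  unfolding subharmonic_def
proof (intro conjI allI impI)
  show "usc (\<lambda>z. ereal (v z))" by (rule usc_ereal_continuous[OF cont])
  fix c :: complex and r :: real assume r: "r > 0"
  have vc: "continuous_on A (\<lambda>\<theta>. v (c + g \<theta>))" if "continuous_on A g" for A :: "'x::topological_space set" and g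
    by (rule continuous_on_compose2[OF cont]) (auto intro: continuous_intros that)
  define I where "I = integral {0..2*pi} (\<lambda>\<theta>. v (c + of_real r * cis \<theta>)) / (2*pi)"
  have cI: "continuous_on {0..2*pi} (\<lambda>\<theta>. v (c + of_real r * cis \<theta>))"
    by (intro vc continuous_intros)
  have "v c \<le> I + e" if e: "e > 0" for e
  proof -
    have "continuous_on (sphere 0 1) (\<lambda>\<zeta>. v (c + of_real r * \<zeta>))" by (intro vc continuous_intros)
    from circle_approx_Re_poly[OF this, of "e/2"] e
    obtain p where "\<forall>\<zeta>\<in>sphere 0 1. \<bar>v (c + of_real r * \<zeta>) - Re (poly p \<zeta>)\<bar> < e / 2" by fastforce
    hence p: "\<bar>v (c + of_real r * \<zeta>) - Re (poly p \<zeta>)\<bar> < e / 2" if "cmod \<zeta> = 1" for \<zeta>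
      using that by simp
    \<comment> \<open>\<open>P\<close> transports the polynomial to the circle about
      \<open>c\<close>. One \<open>e / 2\<close> is lost in the maximum principle, the other in
      averaging.\<close>
    define P where "P z = poly p ((z - c) / of_real r)" for z
    have hol: "P holomorphic_on UNIV" unfolding P_def by (intro holomorphic_intros) (use r in auto)
    have "v c \<le> Re (P c) + e / 2"
    proof (rule max_principle_local_minorants[OF hol r])
      fix \<zeta> assume "\<zeta> \<in> sphere c r"
      hence "cmod ((\<zeta> - c) / of_real r) = 1" using r
        by (simp add: norm_divide dist_norm norm_minus_commute)
      from p[OF this] have "\<bar>v \<zeta> - Re (P \<zeta>)\<bar> < e / 2" using r by (simp add: P_def)
      thus "v \<zeta> \<le> Re (P \<zeta>) + e / 2" by linarith
    qed
    moreover have "2 * pi * Re (P c) \<le> integral {0..2*pi} (\<lambda>\<theta>. v (c + of_real r * cis \<theta>) + e / 2)"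
    proof (rule has_integral_le[OF has_integral_Re_holomorphic_circle[of P c "r + 1" r]])
      show "((\<lambda>\<theta>. v (c + of_real r * cis \<theta>) + e / 2) has_integral
        integral {0..2*pi} (\<lambda>\<theta>. v (c + of_real r * cis \<theta>) + e / 2)) {0..2*pi}"
        by (intro integrable_integral integrable_continuous_real continuous_intros cI)
      fix \<theta> :: real
      have "\<bar>v (c + of_real r * cis \<theta>) - Re (P (c + of_real r * cis \<theta>))\<bar> < e / 2"
        using p[of "cis \<theta>"] r by (simp add: P_def)
      thus "Re (P (c + of_real r * cis \<theta>)) \<le> v (c + of_real r * cis \<theta>) + e / 2"
        by linarith
    qed (use r hol holomorphic_on_subset in auto)
    moreover have "integral {0..2*pi} (\<lambda>\<theta>. v (c + of_real r * cis \<theta>) + e / 2) = 2 * pi * (I + e / 2)"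
      by (subst integral_add[OF integrable_continuous_real[OF cI]]) (auto simp: I_def algebra_simps)
    ultimately have "v c \<le> Re (P c) + e / 2" "2 * pi * Re (P c) \<le> 2 * pi * (I + e / 2)" by simp_all
    hence "v c \<le> Re (P c) + e / 2" "Re (P c) \<le> I + e / 2" by simp_all
    thus ?thesis by linarith
  qed
  hence "v c \<le> I" by (rule field_le_epsilon)
  thus "ereal (v c) \<le> circle_mean (\<lambda>z. ereal (v z)) c r"
    unfolding circle_mean_real[OF cI] I_def by simp
qed simp

end

section \<open>A plurisubharmonic competitor\<close>

text \<open>Split \<open>z\<close> into \<open>q * y\<close> and a remainder. As \<open>y\<close> is
  a real unit vector, the remainder has bilinear square \<open>1 - q\<^sup>2\<close> and Hermitian
  square |z|^2 - |q|^2; the triangle inequality compares them.\<close>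

lemma lagrange_complex:
  fixes z :: "'a \<Rightarrow> complex" and y :: "'a \<Rightarrow> real"
  assumes "(\<Sum>j\<in>J. (z j)\<^sup>2) = 1" "(\<Sum>j\<in>J. (y j)\<^sup>2) = 1"
  defines "q \<equiv> (\<Sum>j\<in>J. of_real (y j) * z j)"
  shows "(cmod q)\<^sup>2 + cmod (1 - q\<^sup>2) \<le> (\<Sum>j\<in>J. (cmod (z j))\<^sup>2)"
proof -
  have y2: "(\<Sum>j\<in>J. (of_real (y j) :: complex)\<^sup>2) = 1"
    using arg_cong[OF assms(2), of complex_of_real] by simp
  have "(\<Sum>j\<in>J. (z j - q * of_real (y j))\<^sup>2) =
      (\<Sum>j\<in>J. (z j)\<^sup>2) - 2 * q * (\<Sum>j\<in>J. of_real (y j) * z j) + q\<^sup>2 * (\<Sum>j\<in>J. (of_real (y j))\<^sup>2)"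
    by (simp add: power2_eq_square algebra_simps sum.distrib sum_subtractf sum_distrib_left)
  also have "\<dots> = 1 - q\<^sup>2" unfolding q_def[symmetric] assms(1) y2 by (simp add: power2_eq_square)
  finally have 1: "1 - q\<^sup>2 = (\<Sum>j\<in>J. (z j - q * of_real (y j))\<^sup>2)" by simp
  have "(\<Sum>j\<in>J. (cmod (z j - q * of_real (y j)))\<^sup>2) =
      (\<Sum>j\<in>J. (cmod (z j))\<^sup>2 - 2 * Re (cnj q * (of_real (y j) * z j)) + (cmod q)\<^sup>2 * (y j)\<^sup>2)"
    unfolding cmod_power2 by (rule sum.cong) (auto simp: power2_eq_square algebra_simps)
  also have "\<dots> = (\<Sum>j\<in>J. (cmod (z j))\<^sup>2) - 2 * Re (cnj q * q) + (cmod q)\<^sup>2"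
    unfolding sum.distrib sum_subtractf sum_distrib_left[symmetric] assms(2) Re_sum[symmetric]
      q_def[symmetric] by simp
  also have "Re (cnj q * q) = (cmod q)\<^sup>2" unfolding cmod_power2 by (simp add: power2_eq_square)
  finally have 2: "(\<Sum>j\<in>J. (cmod (z j - q * of_real (y j)))\<^sup>2) = (\<Sum>j\<in>J. (cmod (z j))\<^sup>2) - (cmod q)\<^sup>2"
    by simp
  have "cmod (1 - q\<^sup>2) \<le> (\<Sum>j\<in>J. (cmod (z j - q * of_real (y j)))\<^sup>2)"
    unfolding 1 by (rule order_trans[OF norm_sum]) (simp add: norm_power)
  thus ?thesis using 2 by simp
qed

lemma arsinh_prod: "(csqrt (1 + p\<^sup>2) + p) * (csqrt (1 + p\<^sup>2) - p) = 1"
  using power2_csqrt[of "1 + p\<^sup>2"] by (simp add: algebra_simps power2_eq_square)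

text \<open>The factors \<open>c + p\<close> and \<open>c - p\<close> are reciprocal, with moduli
  \<open>exp L\<close> and \<open>exp (-L)\<close>; the parallelogram law turns
  \<open>cosh (2 * L)\<close> into |p|^2 + |1 + p^2|.\<close>

lemma Re_Ln_le_arcosh:
  assumes "(cmod p)\<^sup>2 + cmod (1 + p\<^sup>2) \<le> S"
  shows "Re (2 * Ln (p + csqrt (1 + p\<^sup>2))) \<le> arcosh S"
proof -
  define c where "c = csqrt (1 + p\<^sup>2)"
  have prod: "(c + p) * (c - p) = 1" unfolding c_def by (rule arsinh_prod)
  hence nz: "c + p \<noteq> 0" by auto
  define L where "L = ln (cmod (c + p))"
  have eL: "exp L = cmod (c + p)" using nz by (simp add: L_def)
  have "cmod (c + p) * cmod (c - p) = 1" by (metis prod norm_mult norm_one)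
  hence emL: "exp (-L) = cmod (c - p)" using nz by (simp add: exp_minus eL field_simps)
  have "cosh (2 * L) = ((cmod (c + p))\<^sup>2 + (cmod (c - p))\<^sup>2) / 2"
    unfolding cosh_field_def eL[symmetric] emL[symmetric] by (simp flip: exp_double)
  also have "\<dots> = (cmod p)\<^sup>2 + cmod (c\<^sup>2)"
    unfolding norm_power cmod_power2 by (simp add: power2_eq_square algebra_simps)
  also have "c\<^sup>2 = 1 + p\<^sup>2" by (simp add: c_def)
  finally have le: "cosh (2 * L) \<le> S" using assms by simp
  have "2 * L \<le> \<bar>2 * L\<bar>" by simp
  also have "\<dots> = arcosh (cosh \<bar>2 * L\<bar>)" by (rule arcosh_cosh_real[symmetric]) simp
  also have "\<dots> \<le> arcosh S" using le cosh_real_ge_1[of "2 * L"]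
    by (cases "cosh (2 * L) = S") (auto intro!: less_imp_le)
  finally show ?thesis using nz by (simp add: L_def c_def add.commute Re_Ln)
qed

text \<open>The equality case of \<open>Re_Ln_le_arcosh\<close>, which makes the minorant touch at
  the base point.\<close>

lemma Re_Ln_eq_arcosh:
  assumes "\<beta> \<ge> 0"
  shows "Re (2 * Ln (of_real \<beta> + csqrt (1 + (of_real \<beta>)\<^sup>2))) = arcosh (1 + 2 * \<beta>\<^sup>2)"
proof -
  have pos: "\<beta> + sqrt (1 + \<beta>\<^sup>2) > 0" using assms by (meson add_nonneg_pos not_sum_power2_lt_zero real_sqrt_gt_0_iff add_pos_nonneg zero_less_one zero_le_power2)
  have "csqrt (1 + (of_real \<beta>)\<^sup>2) = of_real (sqrt (1 + \<beta>\<^sup>2))"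
    using csqrt_of_real[of "1 + \<beta>\<^sup>2"] by simp
  hence "of_real \<beta> + csqrt (1 + (of_real \<beta>)\<^sup>2) = (of_real (\<beta> + sqrt (1 + \<beta>\<^sup>2)) :: complex)" by simp
  hence "Re (2 * Ln (of_real \<beta> + csqrt (1 + (of_real \<beta>)\<^sup>2))) = 2 * arsinh \<beta>"
    using pos by (simp only: Ln_of_real) (simp add: arsinh_real_def add.commute)
  also have "\<dots> = arcosh (cosh (2 * arsinh \<beta>))"
    using assms by (intro arcosh_cosh_real[symmetric]) (metis arsinh_real_neg_iff mult_nonneg_nonneg not_less zero_le_numeral)
  also have "cosh (2 * arsinh \<beta>) = 1 + 2 * \<beta>\<^sup>2"
    by (simp add: cosh_double cosh_arsinh_real)
  finally show ?thesis .
qed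

lemma sum_cmod_ge_1:
  assumes "(\<Sum>j\<in>J. w j) = (1::complex)"
  shows "(\<Sum>j\<in>J. cmod (w j)) \<ge> 1"
  using norm_sum[of w J] assms by simp

text \<open>With \<open>z j\<close> a square root of \<open>w j\<close>, the sum of the \<open>|w j|\<close> is \<open>|z|\<^sup>2\<close> on the complex sphere
  \<open>z \<cdot> z = 1\<close>. The minorant comes from \<open>lagrange_complex\<close> for the unit vector \<open>y\<close> in the direction of
  the imaginary part of \<open>z\<close> at \<open>\<zeta>0\<close>. Its entries vanish where \<open>w j\<close> does, so only branches of square
  roots of nonvanishing functions are needed.\<close>

lemma arcosh_sum_minorant:
  fixes \<alpha> \<beta> :: "'a \<Rightarrow> complex" and \<zeta>0 :: complex
  assumes J: "finite J" and "(\<Sum>j\<in>J. \<alpha> j) = 1" "(\<Sum>j\<in>J. \<beta> j) = 0"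
  defines "w \<equiv> \<lambda>j \<zeta>. \<alpha> j + \<zeta> * \<beta> j"
  defines "v \<equiv> \<lambda>\<zeta>. arcosh (\<Sum>j\<in>J. cmod (w j \<zeta>))"
  shows "\<exists>r>0. \<exists>F. F holomorphic_on ball \<zeta>0 r \<and> Re (F \<zeta>0) = v \<zeta>0 \<and>
                       (\<forall>\<zeta>\<in>ball \<zeta>0 r. Re (F \<zeta>) \<le> v \<zeta>)"
proof -
  have sum1: "(\<Sum>j\<in>J. w j \<zeta>) = 1" for \<zeta>
    unfolding w_def by (simp add: sum.distrib sum_distrib_left[symmetric] assms(2,3))
  define z0 where "z0 j = csqrt (w j \<zeta>0)" for j
  have z02: "(z0 j)\<^sup>2 = w j \<zeta>0" for j by (simp add: z0_def)
  \<comment> \<open>As \<open>z0\<close> has bilinear square 1, its real and imaginary parts are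
    orthogonal and |Re z0|^2 = 1 + b^2; the sum of the moduli is then
    \<open>1 + 2 * b\<^sup>2\<close>.\<close>
  define b where "b = sqrt (\<Sum>j\<in>J. (Im (z0 j))\<^sup>2)"
  have b2: "b\<^sup>2 = (\<Sum>j\<in>J. (Im (z0 j))\<^sup>2)" by (simp add: b_def sum_nonneg)
  have b0: "b \<ge> 0" by (simp add: b_def sum_nonneg)
  have "(\<Sum>j\<in>J. (z0 j)\<^sup>2) = 1" by (simp add: z02 sum1)
  hence "Re (\<Sum>j\<in>J. (z0 j)\<^sup>2) = 1" and ImZ: "Im (\<Sum>j\<in>J. (z0 j)\<^sup>2) = 0" by simp_all
  hence "(\<Sum>j\<in>J. (Re (z0 j))\<^sup>2) - b\<^sup>2 = 1" by (simp add: b2 sum_subtractf Re_power2)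
  moreover have "(\<Sum>j\<in>J. cmod (w j \<zeta>0)) = (\<Sum>j\<in>J. (Re (z0 j))\<^sup>2) + b\<^sup>2"
    unfolding z02[symmetric] norm_power cmod_power2 by (simp add: b2 sum.distrib)
  ultimately have S0: "(\<Sum>j\<in>J. cmod (w j \<zeta>0)) = 1 + 2 * b\<^sup>2" by simp
  show ?thesis
  proof (cases "b = 0")
    \<comment> \<open>The sum attains its least possible value 1 at \<zeta>0, so the zero function
      is a minorant.\<close>
    case True
    show ?thesis
      by (rule exI[of _ 1], simp, rule exI[of _ "\<lambda>_. 0"])
         (use sum_cmod_ge_1[OF sum1] in \<open>auto simp: v_def S0 True\<close>)
  next
    case False
    hence bpos: "b > 0" using b0 by simp
    define y where "y j = Im (z0 j) / b" for j
    have y2: "(\<Sum>j\<in>J. (y j)\<^sup>2) = 1"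
      using bpos by (simp add: y_def power_divide sum_divide_distrib[symmetric] b2[symmetric])
    define J0 where "J0 = {j\<in>J. w j \<zeta>0 \<noteq> 0}"
    have yJ0: "y j = 0" if "j \<in> J - J0" for j using that by (auto simp: y_def J0_def z0_def)
    \<comment> \<open>Dividing by \<open>w j \<zeta>0\<close> puts the argument of the root at 1 for
      \<zeta>0 and keeps it off the branch cut on \<open>U\<close>.\<close>
    define s where "s j \<zeta> = z0 j * csqrt (w j \<zeta> / w j \<zeta>0)" for j \<zeta>
    have s2: "(s j \<zeta>)\<^sup>2 = w j \<zeta>" if "j \<in> J0" for j \<zeta>
      using that by (simp add: s_def power_mult_distrib z02 J0_def)
    \<comment> \<open>The factor \<open>-\<i>\<close> makes \<open>p \<zeta>0\<close> the positive
      real number \<open>b\<close>, as \<open>Re_Ln_eq_arcosh\<close> requires.\<close>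
    define p where "p \<zeta> = -\<i> * (\<Sum>j\<in>J0. of_real (y j) * s j \<zeta>)" for \<zeta>
    define U where "U = (\<Inter>j\<in>J0. {\<zeta>. 0 < Re (w j \<zeta> / w j \<zeta>0)})"
    have fin: "finite J0" using J by (simp add: J0_def)
    have "open U" unfolding U_def w_def
      by (intro open_INT fin ballI open_Collect_less continuous_intros) (auto simp: J0_def w_def)
    have \<zeta>U: "\<zeta>0 \<in> U" by (auto simp: U_def J0_def)
    have holp: "p holomorphic_on U"
      unfolding p_def s_def w_def
    proof (intro holomorphic_intros)
      fix j \<zeta> assume "j \<in> J0" "\<zeta> \<in> U"
      thus "(\<alpha> j + \<zeta> * \<beta> j) / (\<alpha> j + \<zeta>0 * \<beta> j) \<notin> \<real>\<^sub>\<le>\<^sub>0"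
        by (auto simp: U_def w_def complex_nonpos_Reals_iff)
    qed (auto simp: J0_def w_def)
    \<comment> \<open>Where \<open>p\<close> takes values in \<open>T\<close>, both
      \<open>csqrt\<close> and \<open>Ln\<close> in \<open>F\<close> stay off their cuts.\<close>
    define T where "T = {x. 0 < Re x} \<inter> {x. 0 < Re (1 + x\<^sup>2)}"
    have "open T" unfolding T_def by (intro open_Int open_Collect_less continuous_intros)
    define V where "V = U \<inter> p -` T"
    have "open V" unfolding V_def
      by (rule continuous_open_preimage[OF holomorphic_on_imp_continuous_on[OF holp] \<open>open U\<close> \<open>open T\<close>])
    have p0: "p \<zeta>0 = of_real b"
    proof -
      have "(\<Sum>j\<in>J0. of_real (y j) * s j \<zeta>0) = (\<Sum>j\<in>J. of_real (y j) * z0 j)"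
        by (rule sum.mono_neutral_cong_left) (use J yJ0 in \<open>auto simp: J0_def s_def\<close>)
      also have "\<dots> = \<i> * of_real b"
      proof (rule complex_eqI)
        have "(\<Sum>j\<in>J. y j * Re (z0 j)) = (\<Sum>j\<in>J. 2 * Re (z0 j) * Im (z0 j)) / (2 * b)"
          unfolding sum_divide_distrib y_def by (rule sum.cong) (use bpos in auto)
        thus "Re (\<Sum>j\<in>J. of_real (y j) * z0 j) = Re (\<i> * of_real b)"
          using ImZ by (simp add: Im_power2)
        have "(\<Sum>j\<in>J. y j * Im (z0 j)) = b\<^sup>2 / b"
          unfolding b2 sum_divide_distrib y_def by (rule sum.cong) (auto simp: power2_eq_square)
        thus "Im (\<Sum>j\<in>J. of_real (y j) * z0 j) = Im (\<i> * of_real b)"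
          using bpos by (simp add: power2_eq_square)
      qed
      finally show ?thesis by (simp add: p_def)
    qed
    have "\<zeta>0 \<in> V" using \<zeta>U bpos by (simp add: V_def T_def p0 Re_power2 add_pos_nonneg)
    with \<open>open V\<close> obtain r where r: "r > 0" "ball \<zeta>0 r \<subseteq> V" by (meson openE)
    define F where "F \<zeta> = 2 * Ln (p \<zeta> + csqrt (1 + (p \<zeta>)\<^sup>2))" for \<zeta>
    have holV: "p holomorphic_on V" by (rule holomorphic_on_subset[OF holp]) (auto simp: V_def)
    have "F holomorphic_on V"
      unfolding F_def
    proof (intro holomorphic_intros holV)
      fix \<zeta> assume "\<zeta> \<in> V"
      hence *: "0 < Re (p \<zeta>)" "0 < Re (1 + (p \<zeta>)\<^sup>2)" by (auto simp: V_def T_def)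
      thus "1 + (p \<zeta>)\<^sup>2 \<notin> \<real>\<^sub>\<le>\<^sub>0" by (auto simp: complex_nonpos_Reals_iff)
      have "Re (csqrt (1 + (p \<zeta>)\<^sup>2)) \<ge> 0" using csqrt_principal[of "1 + (p \<zeta>)\<^sup>2"] by auto
      hence "0 < Re (p \<zeta> + csqrt (1 + (p \<zeta>)\<^sup>2))"
        unfolding plus_complex.sel(1) by (rule add_pos_nonneg[OF *(1)])
      thus "p \<zeta> + csqrt (1 + (p \<zeta>)\<^sup>2) \<notin> \<real>\<^sub>\<le>\<^sub>0" by (metis complex_nonpos_Reals_iff not_less)
    qed
    hence "F holomorphic_on ball \<zeta>0 r" using r holomorphic_on_subset by blast
    moreover have "Re (F \<zeta>0) = v \<zeta>0"
      unfolding F_def p0 v_def S0 by (rule Re_Ln_eq_arcosh[OF b0])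
    moreover have "Re (F \<zeta>) \<le> v \<zeta>" for \<zeta>
    proof -
      \<comment> \<open>Outside \<open>J0\<close> the weight \<open>y j\<close> is 0, and any root
        of \<open>w j \<zeta>\<close> serves because the inequality is pointwise in \<zeta>.\<close>
      define z where "z j = (if j \<in> J0 then s j \<zeta> else csqrt (w j \<zeta>))" for j
      have z2: "(z j)\<^sup>2 = w j \<zeta>" for j using s2 by (simp add: z_def)
      have "(\<Sum>j\<in>J. of_real (y j) * z j) = (\<Sum>j\<in>J0. of_real (y j) * s j \<zeta>)"
        by (rule sum.mono_neutral_cong_right) (use J yJ0 in \<open>auto simp: J0_def z_def\<close>)
      also have "\<dots> = \<i> * p \<zeta>" by (simp add: p_def)
      finally have q: "(\<Sum>j\<in>J. of_real (y j) * z j) = \<i> * p \<zeta>" .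
      have "(cmod (\<i> * p \<zeta>))\<^sup>2 + cmod (1 - (\<i> * p \<zeta>)\<^sup>2) \<le> (\<Sum>j\<in>J. (cmod (z j))\<^sup>2)"
        unfolding q[symmetric] by (rule lagrange_complex) (simp_all add: z2 sum1 y2)
      hence "(cmod (p \<zeta>))\<^sup>2 + cmod (1 + (p \<zeta>)\<^sup>2) \<le> (\<Sum>j\<in>J. cmod (w j \<zeta>))"
        by (simp add: norm_mult power_mult_distrib z2 flip: norm_power)
      thus ?thesis unfolding F_def v_def by (rule Re_Ln_le_arcosh)
    qed
    ultimately show ?thesis using r(1) by blast
  qed
qed

lemma subharmonic_arcosh_sum:
  fixes \<alpha> \<beta> :: "'a \<Rightarrow> complex"
  assumes "finite J" "(\<Sum>j\<in>J. \<alpha> j) = 1" "(\<Sum>j\<in>J. \<beta> j) = 0"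
  shows "subharmonic (\<lambda>\<zeta>. ereal (arcosh (\<Sum>j\<in>J. cmod (\<alpha> j + \<zeta> * \<beta> j))))"
proof (rule subharmonic_of_local_minorants)
  have "(\<Sum>j\<in>J. \<alpha> j + \<zeta> * \<beta> j) = 1" for \<zeta>
    by (simp add: sum.distrib sum_distrib_left[symmetric] assms(2,3))
  hence "1 \<le> (\<Sum>j\<in>J. cmod (\<alpha> j + \<zeta> * \<beta> j))" for \<zeta> by (rule sum_cmod_ge_1)
  thus "continuous_on UNIV (\<lambda>\<zeta>. arcosh (\<Sum>j\<in>J. cmod (\<alpha> j + \<zeta> * \<beta> j)))"
    by (intro continuous_on_compose2[OF continuous_on_arcosh[OF order.refl]] continuous_intros) auto
qed (rule arcosh_sum_minorant[OF assms])

lemma arcosh_le_ln: "s \<ge> 1 \<Longrightarrow> arcosh s \<le> ln (2 * s)" for s :: real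
proof -
  assume s: "s \<ge> 1"
  have "sqrt (s\<^sup>2 - 1) \<le> sqrt (s\<^sup>2)" by (rule real_sqrt_le_mono) simp
  hence "s + sqrt (s\<^sup>2 - 1) \<le> 2 * s" using s by simp
  moreover have "0 < s + sqrt (s\<^sup>2 - 1)" using s by (intro add_pos_nonneg) auto
  ultimately show ?thesis unfolding arcosh_real_def[OF s] by (subst ln_le_cancel_iff) auto
qed

text \<open>Along a complex line the forms become \<open>\<alpha> j + \<zeta> * \<beta> j\<close>
  with sums 1 and 0, so \<open>subharmonic_arcosh_sum\<close> applies. Linear growth of the moduli
  and \<open>arcosh_le_ln\<close> give logarithmic growth.\<close>

lemma arcosh_sum_in_lelong_class:
  fixes A :: "'a \<Rightarrow> complex" and c :: "'a \<Rightarrow> complex ^ 'n"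
  assumes J: "finite J" and A: "sum A J = 1" and c: "sum c J = 0"
  defines "w \<equiv> \<lambda>j z. A j + (\<Sum>i\<in>UNIV. c j $ i * z $ i)"
  shows "(\<lambda>z. ereal (arcosh (\<Sum>j\<in>J. cmod (w j z)))) \<in> lelong_class"
proof -
  have c': "(\<Sum>j\<in>J. \<Sum>i\<in>UNIV. c j $ i * z $ i) = 0" for z :: "complex^'n"
  proof -
    have "(\<Sum>j\<in>J. \<Sum>i\<in>UNIV. c j $ i * z $ i) = (\<Sum>i\<in>UNIV. sum c J $ i * z $ i)"
      by (subst sum.swap) (simp add: sum_distrib_right)
    thus ?thesis by (simp add: c)
  qed
  have sum1: "(\<Sum>j\<in>J. w j z) = 1" for z by (simp add: w_def sum.distrib A c')
  note ge1 = sum_cmod_ge_1[OF sum1]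
  have "usc (\<lambda>z. ereal (arcosh (\<Sum>j\<in>J. cmod (w j z))))"
    using ge1
    by (intro usc_ereal_continuous continuous_on_compose2[OF continuous_on_arcosh[OF order.refl]])
       (auto simp: w_def intro!: continuous_intros)
  moreover have "subharmonic (\<lambda>\<zeta>. ereal (arcosh (\<Sum>j\<in>J. cmod (w j (z + \<zeta> *s z')))))" for z z'
  proof -
    have "w j (z + \<zeta> *s z') = w j z + \<zeta> * (\<Sum>i\<in>UNIV. c j $ i * z' $ i)" for j \<zeta>
      by (simp add: w_def algebra_simps sum.distrib sum_distrib_left)
    thus ?thesis using subharmonic_arcosh_sum[OF J sum1 c'] by simp
  qed
  moreover have "\<exists>B::real. \<forall>z. ereal (arcosh (\<Sum>j\<in>J. cmod (w j z))) \<le> ereal (log_plus (norm z) + B)"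
  proof -
    define B where "B = (\<Sum>j\<in>J. cmod (A j) + (\<Sum>i\<in>UNIV. cmod (c j $ i)))"
    have bound: "(\<Sum>j\<in>J. cmod (w j z)) \<le> B * max 1 (norm z)" for z
      unfolding B_def sum_distrib_right
    proof (rule sum_mono)
      fix j
      have "cmod (w j z) \<le> cmod (A j) + (\<Sum>i\<in>UNIV. cmod (c j $ i * z $ i))"
        unfolding w_def by (rule norm_triangle_le) (simp add: norm_sum)
      also have "\<dots> \<le> cmod (A j) * max 1 (norm z) + (\<Sum>i\<in>UNIV. cmod (c j $ i) * max 1 (norm z))"
      proof (intro add_mono sum_mono)
        show "cmod (A j) \<le> cmod (A j) * max 1 (norm z)"
          using mult_left_mono[of 1 "max 1 (norm z)" "cmod (A j)"] by simp
        show "cmod (c j $ i * z $ i) \<le> cmod (c j $ i) * max 1 (norm z)" for i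
          unfolding norm_mult using Finite_Cartesian_Product.norm_nth_le[of z i] by (intro mult_left_mono) auto
      qed
      also have "\<dots> = (cmod (A j) + (\<Sum>i\<in>UNIV. cmod (c j $ i))) * max 1 (norm z)"
        by (simp add: sum_distrib_right distrib_right)
      finally show "cmod (w j z) \<le> \<dots>" .
    qed
    have B: "B \<ge> 1" using bound[of 0] ge1[of 0] by simp
    have "arcosh (\<Sum>j\<in>J. cmod (w j z)) \<le> log_plus (norm z) + ln (2 * B)" for z
    proof -
      have "arcosh (\<Sum>j\<in>J. cmod (w j z)) \<le> ln (2 * (\<Sum>j\<in>J. cmod (w j z)))"
        by (rule arcosh_le_ln[OF ge1])
      also have "\<dots> \<le> ln (2 * B * max 1 (norm z))"
        using ge1[of z] bound[of z] B by (subst ln_le_cancel_iff) auto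
      also have "\<dots> = ln (max 1 (norm z)) + ln (2 * B)"
        using B by (subst ln_mult) auto
      also have "ln (max 1 (norm z)) = log_plus (norm z)"
        using ln_ge_zero[of "norm z"] ln_le_zero_iff[of "norm z"]
        by (cases "norm z \<le> 1"; cases "norm z = 0") (auto simp: log_plus_def max_def)
      finally show ?thesis .
    qed
    thus ?thesis by (intro exI[of _ "ln (2 * B)"]) simp
  qed
  ultimately show ?thesis by (simp add: lelong_class_def plurisubharmonic_def)
qed

text \<open>On \<open>K\<close> the forms are nonnegative with sum 1, so the competitor is
  \<open>arcosh 1 = 0\<close> there. At the complex point, form \<open>j\<close> has imaginary part
  \<open>t * (c j \<bullet> y)\<close>.\<close>

lemma extremal_function_ge_arcosh:
  fixes K :: "(real^'n) set" and A :: "'a \<Rightarrow> real" and c :: "'a \<Rightarrow> real^'n"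
  assumes J: "finite J" and A: "sum A J = 1" and c: "sum c J = 0"
    and nonneg: "\<And>j k. j \<in> J \<Longrightarrow> k \<in> K \<Longrightarrow> A j + c j \<bullet> k \<ge> 0"
  shows "ereal (arcosh (\<Sum>j\<in>J. sqrt ((A j + c j \<bullet> x)\<^sup>2 + t\<^sup>2 * (c j \<bullet> y)\<^sup>2)))
       \<le> extremal_function K (cvec x + (\<i> * of_real t) *s cvec y)"
proof -
  define w where "w j z = of_real (A j) + (\<Sum>i\<in>UNIV. cvec (c j) $ i * z $ i)" for j and z :: "complex^'n"
  define u where "u z = ereal (arcosh (\<Sum>j\<in>J. cmod (w j z)))" for z
  have w: "w j (cvec k + (\<i> * of_real s) *s cvec k') = of_real (A j + c j \<bullet> k) + \<i> * of_real (s * (c j \<bullet> k'))"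
    for j k k' s
    by (simp add: w_def cvec_def inner_vec_def algebra_simps sum.distrib sum_distrib_left)
  have "u \<in> lelong_class"
    unfolding u_def w_def
  proof (rule arcosh_sum_in_lelong_class[OF J])
    show "(\<Sum>j\<in>J. complex_of_real (A j)) = 1" using arg_cong[OF A, of complex_of_real] by simp
    have "(\<Sum>j\<in>J. cvec (c j)) = cvec (sum c J)" by (simp add: cvec_def vec_eq_iff)
    thus "(\<Sum>j\<in>J. cvec (c j)) = 0" by (simp add: c cvec_def vec_eq_iff)
  qed
  moreover have "u (cvec k) \<le> 0" if "k \<in> K" for k
  proof -
    have "(\<Sum>j\<in>J. cmod (w j (cvec k))) = (\<Sum>j\<in>J. A j + c j \<bullet> k)"
      using w[of _ k 0 0] nonneg[OF _ that] by (intro sum.cong) (auto simp del: of_real_add)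
    also have "\<dots> = 1" by (simp add: sum.distrib A c flip: inner_sum_left)
    finally show ?thesis by (simp add: u_def)
  qed
  ultimately have "u z \<le> extremal_function K z" for z
    unfolding extremal_function_def by (intro Sup_upper) auto
  moreover have "cmod (w j (cvec x + (\<i> * of_real t) *s cvec y)) = sqrt ((A j + c j \<bullet> x)\<^sup>2 + t\<^sup>2 * (c j \<bullet> y)\<^sup>2)" for j
    unfolding w by (simp add: cmod_def power_mult_distrib)
  ultimately show ?thesis by (metis (no_types, lifting) u_def sum.cong)
qed

section \<open>Convex duality for inscribed ellipses\<close>

text \<open>The maximum over \<theta> is sqrt (A^2 + Y^2). Comparing its square with that of
  \<open>A + t\<close>, which the hypothesis makes nonnegative, leaves a condition linear in
  \<open>A\<close>.\<close>

lemma cos_sin_combination_le: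
  fixes A Y t \<theta> :: real
  assumes "t > 0" "Y\<^sup>2 / t - t \<le> 2 * A"
  shows "cos \<theta> * A + sin \<theta> * Y \<le> A + t"
proof -
  have "Y\<^sup>2 \<le> (2 * A + t) * t" using assms by (simp add: field_simps)
  hence Y: "Y\<^sup>2 \<le> t\<^sup>2 + 2 * t * A" by (simp add: algebra_simps power2_eq_square)
  have "0 \<le> t * (t + 2 * A)"
    using order_trans[OF zero_le_power2 Y] by (simp add: algebra_simps power2_eq_square)
  hence "t + 2 * A \<ge> 0" using assms(1) by (simp add: zero_le_mult_iff)
  hence nn: "A + t \<ge> 0" using assms(1) by simp
  have "(cos \<theta> * A + sin \<theta> * Y)\<^sup>2 + (sin \<theta> * A - cos \<theta> * Y)\<^sup>2
      = ((sin \<theta>)\<^sup>2 + (cos \<theta>)\<^sup>2) * (A\<^sup>2 + Y\<^sup>2)"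
    by algebra
  hence "(cos \<theta> * A + sin \<theta> * Y)\<^sup>2 + (sin \<theta> * A - cos \<theta> * Y)\<^sup>2 = A\<^sup>2 + Y\<^sup>2" by simp
  moreover have "(sin \<theta> * A - cos \<theta> * Y)\<^sup>2 \<ge> 0" by simp
  moreover have "A\<^sup>2 + Y\<^sup>2 \<le> (A + t)\<^sup>2" using Y by (simp add: power2_eq_square algebra_simps)
  ultimately have "(cos \<theta> * A + sin \<theta> * Y)\<^sup>2 \<le> (A + t)\<^sup>2" by linarith
  thus ?thesis using nn by (rule power2_le_imp_le)
qed

text \<open>A point outside \<open>K\<close> would be strictly cut off by a half-space
  \<open>v \<bullet> (z - x) \<le> t\<close> containing \<open>K\<close>;
  \<open>cos_sin_combination_le\<close> with \<open>v \<bullet> a\<close> and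
  \<open>b * (v \<bullet> y)\<close> keeps the ellipse inside it.\<close>

lemma ellipse_in_convex:
  fixes K :: "(real^'n) set"
  assumes K: "convex K" "closed K" "x \<in> K"
    and a: "\<And>v t. t > 0 \<Longrightarrow> (\<And>z. z \<in> K \<Longrightarrow> v \<bullet> (z - x) \<le> t) \<Longrightarrow> b\<^sup>2 * (v \<bullet> y)\<^sup>2 / t - t \<le> 2 * (v \<bullet> a)"
  shows "ellipse a b x y \<theta> \<in> K"
proof (rule ccontr)
  assume "ellipse a b x y \<theta> \<notin> K"
  then obtain v' c where v': "v' \<bullet> ellipse a b x y \<theta> < c" "\<forall>z\<in>K. v' \<bullet> z > c"
    using separating_hyperplane_closed_point[OF K(1,2)] by blast
  define t where "t = v' \<bullet> x - c"
  have t: "t > 0" using v'(2) K(3) by (simp add: t_def)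
  have "b\<^sup>2 * ((- v') \<bullet> y)\<^sup>2 / t - t \<le> 2 * ((- v') \<bullet> a)"
    using v'(2) by (intro a t) (force simp: t_def inner_diff_right)
  hence "(b * ((- v') \<bullet> y))\<^sup>2 / t - t \<le> 2 * ((- v') \<bullet> a)" by (simp add: power_mult_distrib)
  from cos_sin_combination_le[OF t this, of \<theta>]
  have "v' \<bullet> ellipse a b x y \<theta> \<ge> c"
    by (simp add: ellipse_def inner_simps t_def mult_ac)
  with v'(1) show False by simp
qed

text \<open>The condition that an ellipse lies in a half-space is linear in \<^term>\<open>a\<close>. Therefore the
  absence of an ellipse is certified by a convex combination of half-spaces.\<close>

lemma no_ellipse_certificate:
  fixes K :: "(real^'n) set"
  assumes K: "convex K" "compact K" "x \<in> K"
    and no: "\<And>a. \<exists>\<theta>. ellipse a b x y \<theta> \<notin> K"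
  obtains J :: "((real^'n) \<times> real) set" and \<mu>
  where "finite J" "\<And>v t. (v, t) \<in> J \<Longrightarrow> t > 0" "\<And>v t z. (v, t) \<in> J \<Longrightarrow> z \<in> K \<Longrightarrow> v \<bullet> (z - x) \<le> t"
    "\<And>j. j \<in> J \<Longrightarrow> \<mu> j > 0" "sum \<mu> J = 1" "(\<Sum>j\<in>J. \<mu> j *\<^sub>R fst j) = 0"
    "(\<Sum>j\<in>J. \<mu> j * snd j) \<le> b\<^sup>2 * (\<Sum>j\<in>J. \<mu> j * (fst j \<bullet> y)\<^sup>2 / snd j)"
proof -
  \<comment> \<open>\<open>G\<close> lists half-spaces containing \<open>K\<close> with
    \<open>x\<close> strictly inside, and \<open>h\<close> gives the data of each condition on
    \<open>a\<close>. A point of \<open>C\<close> in \<open>T\<close> is a combination of conditions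
    in which \<open>a\<close> cancels and the constants add up to a nonnegative number.\<close>
  define G where "G = {(v, t) |v t. t > 0 \<and> (\<forall>z\<in>K. v \<bullet> (z - x) \<le> t)}"
  define h where "h = (\<lambda>(v, t). (v, b\<^sup>2 * (v \<bullet> y)\<^sup>2 / t - t))"
  define C where "C = convex hull (h ` G)"
  define T where "T = {0::real^'n} \<times> {0::real..}"
  have "C \<inter> T \<noteq> {}"
  proof
    assume disj: "C \<inter> T = {}"
    have "(0, 1) \<in> G" by (auto simp: G_def)
    hence "C \<noteq> {}" by (auto simp: C_def)
    moreover have "convex C" by (simp add: C_def)
    moreover have "convex T" unfolding T_def by (intro convex_Times) auto
    moreover have "T \<noteq> {}" by (auto simp: T_def)
    ultimately obtain p c where p: "p \<noteq> 0" "\<forall>z\<in>C. p \<bullet> z \<le> c" "\<forall>z\<in>T. c \<le> p \<bullet> z"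
      using separating_hyperplane_sets disj by metis
    obtain \<alpha> \<gamma> where p\<alpha>: "p = (\<alpha>, \<gamma>)" by (cases p)
    have T: "c \<le> \<gamma> * s" if "s \<ge> 0" for s
      using p(3) that by (auto simp: T_def p\<alpha> inner_Pair)
    have c0: "c \<le> 0" using T[of 0] by simp
    have \<gamma>0: "\<gamma> \<ge> 0"
    proof (rule ccontr)
      assume "\<not> \<gamma> \<ge> 0"
      thus False using T[of "(1 - c) / (- \<gamma>)"] c0 by (simp add: field_simps)
    qed
    have G: "\<alpha> \<bullet> v + \<gamma> * (b\<^sup>2 * (v \<bullet> y)\<^sup>2 / t - t) \<le> 0" if "(v, t) \<in> G" for v t
    proof -
      have "h (v, t) \<in> C" using that unfolding C_def by (intro hull_inc imageI)
      thus ?thesis using p(2) c0 by (fastforce simp: h_def p\<alpha> inner_Pair)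
    qed
    show False
    proof (cases "\<gamma> = 0")
      \<comment> \<open>The separating hyperplane is vertical. As \<open>K\<close> is bounded,
        \<alpha> occurs in \<open>G\<close> with a large \<open>t\<close>, which forces \<alpha> to
        vanish.\<close>
      case True
      obtain R where R: "R > 0" "\<And>z. z \<in> K \<Longrightarrow> norm z \<le> R"
        using compact_imp_bounded[OF K(2)] bounded_pos by blast
      have "\<alpha> \<bullet> (z - x) \<le> 1 + norm \<alpha> * (2 * R)" if "z \<in> K" for z
      proof -
        have "\<alpha> \<bullet> (z - x) \<le> norm \<alpha> * norm (z - x)" by (rule norm_cauchy_schwarz)
        also have "norm (z - x) \<le> 2 * R"
          using norm_triangle_ineq4[of z x] R(2)[OF that] R(2)[OF K(3)] by linarith
        finally show ?thesis by (simp add: mult_left_mono)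
      qed
      moreover have "1 + norm \<alpha> * (2 * R) > 0" using R(1) by (simp add: add_pos_nonneg)
      ultimately have "(\<alpha>, 1 + norm \<alpha> * (2 * R)) \<in> G" by (auto simp: G_def)
      from G[OF this] have "\<alpha> = 0" using True inner_ge_zero[of \<alpha>] by (simp add: antisym)
      thus False using p(1) True by (simp add: p\<alpha> zero_prod_def)
    next
      case False
      hence \<gamma>: "\<gamma> > 0" using \<gamma>0 by simp
      \<comment> \<open>Divided by \<gamma>, the separating inequality is exactly the condition on
        this vector for every half-space in \<open>G\<close>.\<close>
      define a where "a = (- 1 / (2 * \<gamma>)) *\<^sub>R \<alpha>"
      have "ellipse a b x y \<theta> \<in> K" for \<theta>
      proof (rule ellipse_in_convex[OF K(1) compact_imp_closed[OF K(2)] K(3)])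
        fix v t assume "t > 0" "\<And>z. z \<in> K \<Longrightarrow> v \<bullet> (z - x) \<le> t"
        hence "(v, t) \<in> G" by (auto simp: G_def)
        from G[OF this] have "\<gamma> * (b\<^sup>2 * (v \<bullet> y)\<^sup>2 / t - t) \<le> \<gamma> * (2 * (v \<bullet> a))"
          using \<gamma> by (simp add: a_def inner_commute)
        thus "b\<^sup>2 * (v \<bullet> y)\<^sup>2 / t - t \<le> 2 * (v \<bullet> a)" using \<gamma> by simp
      qed
      with no show False by blast
    qed
  qed
  then obtain s where s: "s \<ge> 0" "(0, s) \<in> C" by (auto simp: T_def)
  then obtain I u where I: "finite I" "I \<subseteq> h ` G" "\<forall>z\<in>I. 0 \<le> u z" "sum u I = 1"
    "(\<Sum>z\<in>I. u z *\<^sub>R z) = (0, s)"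
    unfolding C_def convex_hull_explicit by blast
  obtain J' where J': "J' \<subseteq> G" "inj_on h J'" "I = h ` J'"
    using I(2) by (meson subset_image_inj)
  have finJ': "finite J'" using I(1) J' finite_imageD by blast
  define \<mu> where "\<mu> = u \<circ> h"
  \<comment> \<open>Zero weights are dropped because the affine forms built from \<open>J\<close>
    must be positive at \<open>x\<close>.\<close>
  define J where "J = {j\<in>J'. \<mu> j > 0}"
  have \<mu>0: "\<mu> j = 0" if "j \<in> J' - J" for j using that I(3) J' by (force simp: J_def \<mu>_def)
  have restr: "(\<Sum>j\<in>J. \<mu> j *\<^sub>R g j) = (\<Sum>j\<in>J'. \<mu> j *\<^sub>R g j)" for g :: "_ \<Rightarrow> 'z::real_vector"
    by (rule sum.mono_neutral_left) (use finJ' \<mu>0 in \<open>auto simp: J_def\<close>)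
  have sums: "(\<Sum>j\<in>J'. \<mu> j *\<^sub>R h j) = (0, s)"
    using I(5) unfolding J'(3) sum.reindex[OF J'(2)] by (simp add: \<mu>_def)
  show thesis
  proof (rule that[of J \<mu>])
    show "finite J" using finJ' by (simp add: J_def)
    show "t > 0" if "(v, t) \<in> J" for v t using that J'(1) by (auto simp: J_def G_def)
    show "v \<bullet> (z - x) \<le> t" if "(v, t) \<in> J" "z \<in> K" for v t z
      using that J'(1) by (auto simp: J_def G_def)
    show "\<mu> j > 0" if "j \<in> J" for j using that by (simp add: J_def)
    show "sum \<mu> J = 1" using restr[of "\<lambda>_. 1::real"] I(4) unfolding J'(3) sum.reindex[OF J'(2)]
      by (simp add: \<mu>_def)
    have hf: "fst (h j) = fst j" for j by (cases j) (simp add: h_def)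
    show "(\<Sum>j\<in>J. \<mu> j *\<^sub>R fst j) = 0"
      unfolding restr using arg_cong[OF sums, of fst] by (simp add: fst_sum hf)
    have hs: "snd (h j) = b\<^sup>2 * (fst j \<bullet> y)\<^sup>2 / snd j - snd j" for j by (cases j) (simp add: h_def)
    have "(\<Sum>j\<in>J. \<mu> j * (b\<^sup>2 * (fst j \<bullet> y)\<^sup>2 / snd j - snd j)) = s"
      using arg_cong[OF sums, of snd] restr[of "\<lambda>j. snd (h j)"] by (simp add: snd_sum hs)
    thus "(\<Sum>j\<in>J. \<mu> j * snd j) \<le> b\<^sup>2 * (\<Sum>j\<in>J. \<mu> j * (fst j \<bullet> y)\<^sup>2 / snd j)"
      using s(1) by (simp add: right_diff_distrib sum_subtractf sum_distrib_left mult_ac)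
  qed
qed

section \<open>The limit\<close>

text \<open>A second order comparison at 0: since the \<open>p j\<close> sum to 1, the sum exceeds 1
  by t^2/2 times the sum of d^2/p up to o(t^2), while cosh (\<kappa> t) exceeds 1 by \<kappa>^2
  t^2/2 up to o(t^2).\<close>

lemma eventually_arcosh_sum_ge:
  fixes p d :: "'a \<Rightarrow> real"
  assumes J: "finite J" and p: "\<And>j. j \<in> J \<Longrightarrow> p j > 0" "sum p J = 1"
    and \<kappa>: "0 \<le> \<kappa>" "\<kappa>\<^sup>2 < (\<Sum>j\<in>J. (d j)\<^sup>2 / p j)"
  shows "eventually (\<lambda>t. \<kappa> * t \<le> arcosh (\<Sum>j\<in>J. sqrt ((p j)\<^sup>2 + t\<^sup>2 * (d j)\<^sup>2))) (at_right 0)"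
proof -
  have lim: "((\<lambda>t. (sqrt (a\<^sup>2 + t\<^sup>2 * e\<^sup>2) - a) / t\<^sup>2) \<longlongrightarrow> e\<^sup>2 / a / 2) (at_right 0)" if "a > 0" for a e :: real
  proof (cases "e = 0")
    case False
    have eq: "e\<^sup>2 / a / 2 = \<bar>a\<bar> * (inverse (a\<^sup>2) * e\<^sup>2) / 2"
      using that by (simp add: field_simps power2_eq_square)
    show ?thesis unfolding eq using that False by real_asymp
  qed (use that in simp)
  have "((\<lambda>t. \<Sum>j\<in>J. (sqrt ((p j)\<^sup>2 + t\<^sup>2 * (d j)\<^sup>2) - p j) / t\<^sup>2) \<longlongrightarrow> (\<Sum>j\<in>J. (d j)\<^sup>2 / p j / 2)) (at_right 0)"
    by (intro tendsto_sum lim p)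
  moreover have "(\<lambda>t. \<Sum>j\<in>J. (sqrt ((p j)\<^sup>2 + t\<^sup>2 * (d j)\<^sup>2) - p j) / t\<^sup>2) =
     (\<lambda>t. ((\<Sum>j\<in>J. sqrt ((p j)\<^sup>2 + t\<^sup>2 * (d j)\<^sup>2)) - 1) / t\<^sup>2)"
    by (simp add: sum_divide_distrib[symmetric] sum_subtractf p(2))
  ultimately have 1: "((\<lambda>t. ((\<Sum>j\<in>J. sqrt ((p j)\<^sup>2 + t\<^sup>2 * (d j)\<^sup>2)) - 1) / t\<^sup>2) \<longlongrightarrow> (\<Sum>j\<in>J. (d j)\<^sup>2 / p j) / 2) (at_right 0)"
    by (simp add: sum_divide_distrib)
  have 2: "((\<lambda>t. (cosh (\<kappa> * t) - 1) / t\<^sup>2) \<longlongrightarrow> \<kappa>\<^sup>2 / 2) (at_right 0)"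
  proof (cases "\<kappa> = 0")
    case False
    hence "\<kappa> > 0" using \<kappa>(1) by simp
    thus ?thesis unfolding cosh_field_def power2_eq_square by real_asymp
  qed simp
  obtain m where m: "\<kappa>\<^sup>2 / 2 < m" "m < (\<Sum>j\<in>J. (d j)\<^sup>2 / p j) / 2"
    using dense[of "\<kappa>\<^sup>2 / 2" "(\<Sum>j\<in>J. (d j)\<^sup>2 / p j) / 2"] \<kappa>(2) by auto
  have "eventually (\<lambda>t. (cosh (\<kappa> * t) - 1) / t\<^sup>2 < m) (at_right 0)"
    by (rule order_tendstoD(2)[OF 2 m(1)])
  moreover have "eventually (\<lambda>t. m < ((\<Sum>j\<in>J. sqrt ((p j)\<^sup>2 + t\<^sup>2 * (d j)\<^sup>2)) - 1) / t\<^sup>2) (at_right 0)"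
    by (rule order_tendstoD(1)[OF 1 m(2)])
  moreover have "eventually (\<lambda>t::real. t > 0) (at_right 0)" by (rule eventually_at_right_less)
  ultimately show ?thesis
  proof eventually_elim
    case (elim t)
    define S where "S = (\<Sum>j\<in>J. sqrt ((p j)\<^sup>2 + t\<^sup>2 * (d j)\<^sup>2))"
    have "(cosh (\<kappa> * t) - 1) / t\<^sup>2 < (S - 1) / t\<^sup>2" using elim by (simp add: S_def)
    hence lt: "cosh (\<kappa> * t) < S" using elim by (simp add: divide_less_cancel)
    have "\<kappa> * t = arcosh (cosh (\<kappa> * t))" using \<kappa>(1) elim by (intro arcosh_cosh_real[symmetric]) simp
    also have "\<dots> \<le> arcosh S" using lt cosh_real_ge_1[of "\<kappa> * t"] by (intro less_imp_le) simp
    finally show ?case by (simp add: S_def)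
  qed
qed

lemma arsinh_le_self:
  assumes "x \<ge> (0::real)"
  shows "arsinh x \<le> x"
proof -
  have "x\<^sup>2 + 1 \<le> (1 + x\<^sup>2 / 2)\<^sup>2" using zero_le_power2[of "x\<^sup>2 / 2"] by (simp add: power2_sum)
  hence "sqrt (x\<^sup>2 + 1) \<le> 1 + x\<^sup>2 / 2" by (intro real_le_lsqrt) auto
  hence "x + sqrt (x\<^sup>2 + 1) \<le> exp x"
    using exp_lower_Taylor_quadratic[OF assms] by simp
  hence "ln (x + sqrt (x\<^sup>2 + 1)) \<le> ln (exp x)"
    using arsinh_real_aux[of x] by (subst ln_le_cancel_iff) auto
  thus ?thesis by (simp add: arsinh_real_def)
qed

lemma ellipse_real:
  assumes "\<And>\<theta>. \<theta> \<in> {0..2*pi} \<Longrightarrow> ellipse a b x y \<theta> \<in> K"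
  shows "ellipse a b x y \<theta> \<in> K"
proof -
  obtain \<theta>' where "0 \<le> \<theta>'" "\<theta>' < 2 * pi" "cos \<theta> = cos \<theta>'" "sin \<theta> = sin \<theta>'"
    using sincos_total_2pi[of "cos \<theta>" "sin \<theta>"] by auto
  thus ?thesis using assms[of \<theta>'] by (simp add: ellipse_def)
qed

text \<open>The curve with coefficients \<open>A\<close> and \<open>\<i> *s B\<close> runs through
  the real ellipse at \<tau> = \<i> \<theta>; the minus sign comes from sinh (\<i> \<theta>) = \<i>
  sin \<theta>. Then \<open>lelong_le_on_conic\<close> is evaluated at \<tau> = s.\<close>

lemma extremal_function_le_of_ellipse:
  fixes K :: "(real^'n) set"
  assumes inK: "\<And>\<theta>. Z + cos \<theta> *\<^sub>R A - sin \<theta> *\<^sub>R B \<in> K" and s: "s \<ge> 0"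
  shows "extremal_function K (cvec (Z + cosh s *\<^sub>R A) + (\<i> * of_real (sinh s)) *s cvec B) \<le> ereal s"
  unfolding extremal_function_def
proof (rule Sup_least, clarify)
  fix u :: "complex^'n \<Rightarrow> ereal"
  assume u: "u \<in> lelong_class" "\<forall>k\<in>K. u (cvec k) \<le> 0"
  define f where "f = (\<lambda>\<tau>. cvec Z + cosh \<tau> *s cvec A + sinh \<tau> *s (\<i> *s cvec B))"
  have cs: "cosh (\<i> * of_real \<theta>) = of_real (cos \<theta>)" "sinh (\<i> * of_real \<theta>) = \<i> * of_real (sin \<theta>)" for \<theta> :: real
    using cos_conv_cosh[of "of_real \<theta>"] sin_conv_sinh[of "of_real \<theta>"]
    by (simp_all add: cos_of_real sin_of_real)
  have hs: "cosh (of_real s :: complex) = of_real (cosh s)" "sinh (of_real s :: complex) = of_real (sinh s)"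
    by (simp_all add: cosh_field_def sinh_field_def exp_of_real flip: of_real_minus)
  have "u (f (of_real s)) \<le> ereal (Re (of_real s))"
    unfolding f_def
  proof (rule lelong_le_on_conic[OF u(1)])
    fix \<theta> :: real
    have "cvec Z + cosh (\<i> * of_real \<theta>) *s cvec A + sinh (\<i> * of_real \<theta>) *s (\<i> *s cvec B)
      = cvec (Z + cos \<theta> *\<^sub>R A - sin \<theta> *\<^sub>R B)"
      unfolding cs by (simp add: cvec_def vec_eq_iff complex_eq_iff)
    thus "u (cvec Z + cosh (\<i> * of_real \<theta>) *s cvec A + sinh (\<i> * of_real \<theta>) *s (\<i> *s cvec B)) \<le> 0"
      using u(2) inK by simp
  qed (use s in simp)
  moreover have "f (of_real s) = cvec (Z + cosh s *\<^sub>R A) + (\<i> * of_real (sinh s)) *s cvec B"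
    unfolding f_def hs by (simp add: cvec_def vec_eq_iff)
  ultimately show "u (cvec (Z + cosh s *\<^sub>R A) + (\<i> * of_real (sinh s)) *s cvec B) \<le> ereal s" by simp
qed

lemma extremal_quotient_bound:
  assumes "t > 0"
  shows "extremal_function K (cvec x + (\<i> * of_real t) *s cvec y) \<le> ereal (\<kappa> * t) \<Longrightarrow>
           extremal_quotient K x y t \<le> ereal \<kappa>"
    and "ereal (\<kappa> * t) \<le> extremal_function K (cvec x + (\<i> * of_real t) *s cvec y) \<Longrightarrow>
           ereal \<kappa> \<le> extremal_quotient K x y t"
proof -
  have eq: "ereal \<kappa> = ereal (\<kappa> * t) / ereal t" using assms by simp
  show "extremal_quotient K x y t \<le> ereal \<kappa>"
    if "extremal_function K (cvec x + (\<i> * of_real t) *s cvec y) \<le> ereal (\<kappa> * t)"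
    unfolding extremal_quotient_def eq by (rule ereal_divide_right_mono) (use that assms in auto)
  show "ereal \<kappa> \<le> extremal_quotient K x y t"
    if "ereal (\<kappa> * t) \<le> extremal_function K (cvec x + (\<i> * of_real t) *s cvec y)"
    unfolding extremal_quotient_def eq by (rule ereal_divide_right_mono) (use that assms in auto)
qed

section \<open>Bounds for the quotient at a fixed interior point and direction\<close>

context
  fixes K :: "(real ^ 'n) set" and x y :: "real ^ 'n"
  assumes body: "convex_body K" and x: "x \<in> interior K" and y: "y \<noteq> 0"
begin

lemma convex_body_facts: "convex K" "compact K" "x \<in> K"
  using body x interior_subset by (auto simp: convex_body_def)

lemma eventually_extremal_quotient_le:
  assumes a: "\<And>\<theta>. \<theta> \<in> {0..2*pi} \<Longrightarrow> ellipse a b x y \<theta> \<in> K" and b': "0 < b'" "b' < b"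
  shows "eventually (\<lambda>t. extremal_quotient K x y t \<le> ereal (1 / b')) (at_right 0)"
proof -
  \<comment> \<open>Shrinking towards \<open>x\<close> by the factor \<open>l\<close> turns
    \<open>b\<close> into \<open>b'\<close> and leaves room for a translation of norm below
    \<open>(1 - l) * r\<close>.\<close>
  define l where "l = b' / b"
  have l: "0 < l" "l < 1" "l * b = b'" using b' by (auto simp: l_def)
  obtain r where r: "r > 0" "ball x r \<subseteq> K" using x by (auto simp: mem_interior)
  have "((\<lambda>t. norm a * (sqrt ((t / b')\<^sup>2 + 1) - 1)) \<longlongrightarrow> norm a * (sqrt ((0 / b')\<^sup>2 + 1) - 1)) (at_right 0)"
    by (intro tendsto_intros) (use b' in auto)
  hence "((\<lambda>t. norm a * (sqrt ((t / b')\<^sup>2 + 1) - 1)) \<longlongrightarrow> 0) (at_right 0)" by simp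
  moreover have "(1 - l) * r > 0" using l r by simp
  ultimately have "eventually (\<lambda>t. norm a * (sqrt ((t / b')\<^sup>2 + 1) - 1) < (1 - l) * r) (at_right 0)"
    by (rule order_tendstoD(2))
  moreover have "eventually (\<lambda>t::real. t > 0) (at_right 0)" by (rule eventually_at_right_less)
  ultimately show ?thesis
  proof eventually_elim
    case (elim t)
    define s where "s = arsinh (t / b')"
    have tb: "t / b' > 0" using elim b' by simp
    have s0: "s \<ge> 0" using arsinh_real_pos_iff[of "t / b'"] tb unfolding s_def by linarith
    have sb: "b' * sinh s = t" using b' by (simp add: s_def)
    have ch: "cosh s = sqrt ((t / b')\<^sup>2 + 1)" unfolding s_def by (rule cosh_arsinh_real)
    \<comment> \<open>Translation by \<open>w\<close> moves the centre
      \<open>x - l *\<^sub>R a\<close> to \<open>x - (l * cosh s) *\<^sub>R a\<close>, so that the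
      complexified curve meets \<open>x + \<i> t y\<close> at parameter \<open>s\<close>.\<close>
    define w where "w = (l * (1 - cosh s)) *\<^sub>R a"
    have "norm w \<le> norm a * (cosh s - 1)"
    proof -
      have "norm w = l * (norm a * (cosh s - 1))"
        using l cosh_real_ge_1[of s] by (simp add: w_def abs_mult)
      also have "\<dots> \<le> 1 * (norm a * (cosh s - 1))"
        using l cosh_real_ge_1[of s] by (intro mult_right_mono mult_nonneg_nonneg) auto
      finally show ?thesis by simp
    qed
    hence w: "norm w < (1 - l) * r" using elim ch by simp
    have "x + (1 / (1 - l)) *\<^sub>R w \<in> ball x r" using w l by (simp add: dist_norm field_simps)
    hence w': "x + (1 / (1 - l)) *\<^sub>R w \<in> K" using r by blast
    have "x - (l * cosh s) *\<^sub>R a + cos \<theta> *\<^sub>R l *\<^sub>R a - sin \<theta> *\<^sub>R b' *\<^sub>R y \<in> K" for \<theta>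
    proof -
      have "l *\<^sub>R ellipse a b x y (- \<theta>) + (1 - l) *\<^sub>R (x + (1 / (1 - l)) *\<^sub>R w) \<in> K"
        using l by (intro convexD[OF convex_body_facts(1) ellipse_real[OF a] w']) auto
      also have "l *\<^sub>R ellipse a b x y (- \<theta>) + (1 - l) *\<^sub>R (x + (1 / (1 - l)) *\<^sub>R w) =
        x - (l * cosh s) *\<^sub>R a + cos \<theta> *\<^sub>R l *\<^sub>R a - sin \<theta> *\<^sub>R b' *\<^sub>R y"
      proof -
        have "(1 - l) *\<^sub>R (x + (1 / (1 - l)) *\<^sub>R w) = (1 - l) *\<^sub>R x + w"
          using l by (simp add: scaleR_add_right)
        thus ?thesis unfolding ellipse_def w_def l(3)[symmetric] by (simp add: algebra_simps)
      qed
      finally show ?thesis .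
    qed
    from extremal_function_le_of_ellipse[OF this s0]
    have "extremal_function K (cvec (x - (l * cosh s) *\<^sub>R a + cosh s *\<^sub>R l *\<^sub>R a) + (\<i> * of_real (sinh s)) *s cvec (b' *\<^sub>R y)) \<le> ereal s" .
    also have "x - (l * cosh s) *\<^sub>R a + cosh s *\<^sub>R l *\<^sub>R a = x" by (simp add: mult.commute)
    also have "(\<i> * of_real (sinh s)) *s cvec (b' *\<^sub>R y) = (\<i> * of_real t) *s cvec y"
      unfolding sb[symmetric] by (simp add: cvec_def vec_eq_iff)
    also have "ereal s \<le> ereal (1 / b' * t)"
      using arsinh_le_self[of "t / b'"] tb by (simp add: s_def)
    finally show ?case using elim by (intro extremal_quotient_bound(1)) auto
  qed
qed

lemma eventually_extremal_quotient_ge: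
  assumes no: "\<And>a. \<exists>\<theta>\<in>{0..2*pi}. ellipse a b x y \<theta> \<notin> K" and b: "b > 0" and \<kappa>: "0 \<le> \<kappa>" "\<kappa> < 1 / b"
  shows "eventually (\<lambda>t. ereal \<kappa> \<le> extremal_quotient K x y t) (at_right 0)"
proof -
  have "\<exists>\<theta>. ellipse a b x y \<theta> \<notin> K" for a using no by blast
  then obtain J :: "((real^'n) \<times> real) set" and \<mu> where J: "finite J"
    and t: "\<And>v t. (v, t) \<in> J \<Longrightarrow> t > 0" and le: "\<And>v t z. (v, t) \<in> J \<Longrightarrow> z \<in> K \<Longrightarrow> v \<bullet> (z - x) \<le> t"
    and \<mu>: "\<And>j. j \<in> J \<Longrightarrow> \<mu> j > 0" "sum \<mu> J = 1" and \<mu>v: "(\<Sum>j\<in>J. \<mu> j *\<^sub>R fst j) = 0"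
    and opt: "(\<Sum>j\<in>J. \<mu> j * snd j) \<le> b\<^sup>2 * (\<Sum>j\<in>J. \<mu> j * (fst j \<bullet> y)\<^sup>2 / snd j)"
    by (rule no_ellipse_certificate[OF convex_body_facts, of b y]) (rule that)
  \<comment> \<open>The certificate becomes the affine forms
    \<open>\<mu> j / M * (t - v \<bullet> (z - x))\<close> for \<open>j = (v, t)\<close>, with value
    \<open>p j\<close> at \<open>x\<close> and gradient \<open>c j\<close>; this \<open>M\<close>
    makes them sum to 1.\<close>
  define M where "M = (\<Sum>j\<in>J. \<mu> j * snd j)"
  have tpos: "snd j > 0" if "j \<in> J" for j using t[of "fst j" "snd j"] that by simp
  have "J \<noteq> {}" using \<mu>(2) by auto
  hence M: "M > 0" unfolding M_def by (intro sum_pos J) (use \<mu> tpos in auto)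
  define p where "p j = \<mu> j * snd j / M" for j
  define c where "c j = (- \<mu> j / M) *\<^sub>R fst j" for j
  define A where "A j = p j - c j \<bullet> x" for j
  have sumc: "sum c J = 0"
  proof -
    have "sum c J = (- 1 / M) *\<^sub>R (\<Sum>j\<in>J. \<mu> j *\<^sub>R fst j)"
      unfolding scaleR_sum_right c_def by (intro sum.cong) auto
    thus ?thesis by (simp add: \<mu>v)
  qed
  have sump: "sum p J = 1" using M by (simp add: p_def sum_divide_distrib[symmetric] M_def[symmetric])
  have sumA: "sum A J = 1" by (simp add: A_def sum_subtractf sump sumc flip: inner_sum_left)
  have nonneg: "A j + c j \<bullet> k \<ge> 0" if "j \<in> J" "k \<in> K" for j k
  proof -
    have "A j + c j \<bullet> k = \<mu> j / M * (snd j - fst j \<bullet> (k - x))"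
      by (simp add: A_def p_def c_def inner_diff_right diff_divide_distrib algebra_simps)
    moreover have "fst j \<bullet> (k - x) \<le> snd j" using le[of "fst j" "snd j" k] that by simp
    moreover have "\<mu> j / M \<ge> 0" using \<mu>(1)[OF that(1)] M by simp
    ultimately show ?thesis by (metis diff_ge_0_iff_ge mult_nonneg_nonneg)
  qed
  have ppos: "p j > 0" if "j \<in> J" for j using \<mu>(1) tpos M that by (simp add: p_def)
  have "(\<Sum>j\<in>J. (c j \<bullet> y)\<^sup>2 / p j) = (\<Sum>j\<in>J. \<mu> j * (fst j \<bullet> y)\<^sup>2 / snd j) / M"
    unfolding sum_divide_distrib
  proof (rule sum.cong)
    fix j assume j: "j \<in> J"
    show "(c j \<bullet> y)\<^sup>2 / p j = \<mu> j * (fst j \<bullet> y)\<^sup>2 / snd j / M"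
      using \<mu>(1)[OF j] tpos[OF j] M by (simp add: c_def p_def field_simps power2_eq_square)
  qed simp
  moreover have "1 / b\<^sup>2 \<le> (\<Sum>j\<in>J. \<mu> j * (fst j \<bullet> y)\<^sup>2 / snd j) / M"
    using opt M b unfolding M_def[symmetric] by (simp add: field_simps)
  ultimately have "1 / b\<^sup>2 \<le> (\<Sum>j\<in>J. (c j \<bullet> y)\<^sup>2 / p j)" by simp
  moreover have "\<kappa>\<^sup>2 < (1 / b)\<^sup>2" using \<kappa> by (intro power_strict_mono) auto
  ultimately have "\<kappa>\<^sup>2 < (\<Sum>j\<in>J. (c j \<bullet> y)\<^sup>2 / p j)" by (simp add: power_divide)
  from eventually_arcosh_sum_ge[OF J ppos sump \<kappa>(1) this]
  have "eventually (\<lambda>t. \<kappa> * t \<le> arcosh (\<Sum>j\<in>J. sqrt ((p j)\<^sup>2 + t\<^sup>2 * (c j \<bullet> y)\<^sup>2))) (at_right 0)" .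
  moreover have "eventually (\<lambda>t::real. t > 0) (at_right 0)" by (rule eventually_at_right_less)
  ultimately show ?thesis
  proof eventually_elim
    case (elim t)
    have "p j = A j + c j \<bullet> x" for j by (simp add: A_def)
    hence "ereal (\<kappa> * t) \<le> ereal (arcosh (\<Sum>j\<in>J. sqrt ((A j + c j \<bullet> x)\<^sup>2 + t\<^sup>2 * (c j \<bullet> y)\<^sup>2)))"
      using elim by simp
    also have "\<dots> \<le> extremal_function K (cvec x + (\<i> * of_real t) *s cvec y)"
      by (rule extremal_function_ge_arcosh[OF J sumA sumc nonneg])
    finally show ?case using elim by (intro extremal_quotient_bound(2))
  qed
qed

section \<open>The supremum over inscribed ellipses and passage to the limit\<close>

abbreviation "inscribed \<equiv> {b. b > 0 \<and> (\<exists>a. \<forall>\<theta>\<in>{0..2 * pi}. ellipse a b x y \<theta> \<in> K)}"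

lemma inscribed_nonempty: "inscribed \<noteq> {}"
proof -
  obtain r where r: "r > 0" "ball x r \<subseteq> K" using x by (auto simp: mem_interior)
  define b where "b = r / (2 * norm y)"
  have b: "b > 0" "b * norm y < r" using r y by (auto simp: b_def)
  have "ellipse 0 b x y \<theta> \<in> K" for \<theta>
  proof -
    have "norm ((b * sin \<theta>) *\<^sub>R y) \<le> b * norm y"
      using b(1) abs_sin_le_one[of \<theta>] by (simp add: abs_mult mult_right_mono mult_left_le)
    hence "ellipse 0 b x y \<theta> \<in> ball x r" using b(2) by (simp add: ellipse_def dist_norm)
    thus ?thesis using r(2) by blast
  qed
  thus ?thesis using b(1) by blast
qed

lemma inscribed_bdd_above: "bdd_above inscribed"
proof -
  obtain R where R: "\<And>z. z \<in> K \<Longrightarrow> norm z \<le> R"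
    using compact_imp_bounded[OF convex_body_facts(2)] bounded_iff by blast
  have "b \<le> R / norm y" if b: "b \<in> inscribed" for b
  proof -
    obtain a where a: "\<And>\<theta>. \<theta> \<in> {0..2*pi} \<Longrightarrow> ellipse a b x y \<theta> \<in> K" and b0: "b > 0" using b by blast
    have "norm (ellipse a b x y (pi/2) - ellipse a b x y (3/2*pi)) \<le> R + R"
      by (rule order_trans[OF norm_triangle_ineq4 add_mono]) (intro R a; simp)+
    moreover have "ellipse a b x y (pi/2) - ellipse a b x y (3/2*pi) = (2 * b) *\<^sub>R y"
      unfolding ellipse_def sin_3over2_pi cos_3over2_pi by (simp flip: scaleR_add_left)
    ultimately show ?thesis using b0 y by (simp add: field_simps)
  qed
  thus ?thesis by (auto simp: bdd_above_def)
qed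

lemma b_star_pos: "b_star K x y > 0"
proof -
  obtain b where "b \<in> inscribed" using inscribed_nonempty by blast
  moreover from this have "b \<le> b_star K x y"
    unfolding b_star_def by (intro cSup_upper inscribed_bdd_above)
  ultimately show ?thesis by force
qed

lemma tendsto_extremal_quotient:
  "(extremal_quotient K x y \<longlongrightarrow> ereal (1 / b_star K x y)) (at_right 0)"
proof (rule order_tendstoI)
  fix e assume "e < ereal (1 / b_star K x y)"
  then obtain \<kappa> where \<kappa>: "e < ereal \<kappa>" "\<kappa> < 1 / b_star K x y" using ereal_dense2 by (metis ereal_less(1) less_ereal.simps(1))
  define \<kappa>' where "\<kappa>' = max 0 \<kappa>"
  have \<kappa>': "0 \<le> \<kappa>'" "\<kappa>' < 1 / b_star K x y" using \<kappa>(2) b_star_pos by (auto simp: \<kappa>'_def)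
  \<comment> \<open>\<open>1 / b\<close> is the midpoint of \<kappa>' and
    \<open>1 / b_star K x y\<close>.\<close>
  define b where "b = 2 / (1 / b_star K x y + \<kappa>')"
  have b: "b_star K x y < b" "b > 0" "\<kappa>' < 1 / b"
    using \<kappa>' b_star_pos by (auto simp: b_def field_simps add_pos_nonneg)
  have "b \<notin> inscribed"
    using cSup_upper[OF _ inscribed_bdd_above, of b] b(1) by (auto simp: b_star_def)
  hence "\<exists>\<theta>\<in>{0..2*pi}. ellipse a b x y \<theta> \<notin> K" for a using b(2) by blast
  from eventually_extremal_quotient_ge[OF this b(2) \<kappa>'(1) b(3)]
  show "eventually (\<lambda>t. e < extremal_quotient K x y t) (at_right 0)"
  proof eventually_elim
    case (elim t)
    have "e < ereal \<kappa>'" using \<kappa>(1) by (rule less_le_trans) (simp add: \<kappa>'_def)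
    thus ?case using elim by (rule less_le_trans)
  qed
next
  fix e assume "ereal (1 / b_star K x y) < e"
  then obtain \<kappa> where \<kappa>: "1 / b_star K x y < \<kappa>" "ereal \<kappa> < e" using ereal_dense2 by (metis less_ereal.simps(1))
  have \<kappa>0: "\<kappa> > 0" using \<kappa>(1) b_star_pos by (smt (verit) divide_pos_pos)
  \<comment> \<open>\<open>1 / \<kappa>\<close> serves as \<open>b'\<close> in the upper estimate:
    it lies below the supremum, hence below some inscribed \<open>b\<close>.\<close>
  hence "1 / \<kappa> < b_star K x y" using \<kappa>(1) b_star_pos by (simp add: field_simps)
  then obtain b where b: "b \<in> inscribed" "1 / \<kappa> < b"
    unfolding b_star_def using less_cSupD[OF inscribed_nonempty] by blast
  then obtain a where "\<And>\<theta>. \<theta> \<in> {0..2*pi} \<Longrightarrow> ellipse a b x y \<theta> \<in> K" by blast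
  from eventually_extremal_quotient_le[OF this _ b(2)] \<kappa>0
  have "eventually (\<lambda>t. extremal_quotient K x y t \<le> ereal \<kappa>) (at_right 0)" by simp
  thus "eventually (\<lambda>t. extremal_quotient K x y t < e) (at_right 0)"
    by eventually_elim (rule le_less_trans[OF _ \<kappa>(2)])
qed

end

theorem theorem4p1:
  fixes K :: "(real ^ 'n) set" and x y :: "real ^ 'n"
  assumes "convex_body K" and "x \<in> interior K" and "y \<noteq> 0"
  shows "(extremal_quotient K x y \<longlongrightarrow> delta_B K x y) (at_right 0) \<and>
         delta_B K x y = ereal (1 / b_star K x y)"
proof -
  note lim = tendsto_extremal_quotient[OF assms]
  have "delta_B K x y = ereal (1 / b_star K x y)"
    unfolding delta_B_def by (rule tendsto_Lim[OF _ lim]) simp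
  with lim show ?thesis by simp
qed

end
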